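(* Let $\Gamma=(V,E)$ be a finite hypergraph, $\mathbb{V}$ a real vector space of dimension $n$, and $U\subseteq\mathrm{Gr}(s,\mathbb{V})^{|V|}$ a semi-algebraic subset such that for every hyperedge $e=\{u_1,\dots,u_k\}\in E$ the function $(S_v)_{v\in V}\mapsto\dim\big(\bigcap_{i=1}^kS_{u_i}\big)$ is constant on $U$. Regard points of $U$ as motion sheaves $\mathcal{M}$ on $I(\Gamma)$, and define $h^0(\mathcal{M})=\dim H^0(I(\Gamma),\mathcal{M})$, $h^1(\mathcal{M})=\dim H^1(I(\Gamma),\mathcal{M})$. Then $h^0$ and $h^1$ are upper semi-continuous on $U$ with respect to the Zariski topology restricted to $U$. In particular, there is a Zariski open subset of $U$ on which $h^0$ and $h^1$ attain their minimum values.
   Context: $\mathrm{Gr}(s,\mathbb{V})$ is viewed as a real algebraic variety: after fixing $\mathbb{V}\cong\mathbb{R}^n$ with an inner product, as the affine variety of orthogonal projections $P$ with $P=P^t$, $P^2=P$, $\mathrm{Tr}P=s$. A function $f:X\to\mathbb{Z}$ is upper semi-continuous if $f^{-1}((-\infty,a))$ is open for each $a$. $I(\Gamma)$ is the incidence graph (vertices $V\cup E$, edge $v\sim e$ iff $v\in e$). The motion sheaf of $(S_v)_v$: $\mathcal{M}(v)=\mathbb{V}/S_v$, $\mathcal{M}(e)=\mathbb{V}/\bigcap_{v\in e}S_v$, $\mathcal{M}(v\sim e)=\mathbb{V}/S_v$, restriction maps identity and reduction. $H^0=\ker d$, $H^1=\operatorname{coker} d$ for the signed coboundary $d(w)_i=\sum_{x\in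 i}[x:i]r^x_i(w_x)$, $[x:i]=-[y:i]$ for $i=xy$. *)

theory Defs
  imports "HOL-Algebra.AbelCoset" "Jordan_Normal_Form.VS_Connect" "HOL-Analysis.Abstract_Topology"
begin

section \<open>Real vector spaces with explicit carriers\<close>

abbreviation real_vectorspace :: "(real, 'a) module \<Rightarrow> bool" where
  "real_vectorspace M \<equiv> vectorspace class_ring M"

abbreviation vdim :: "(real, 'a) module \<Rightarrow> nat" where
  "vdim M \<equiv> vectorspace.dim class_ring M"

text \<open>The quotient of \<open>M\<close> by a subspace \<open>N\<close>, with cosets as elements. The ring operations
  \<open>mult\<close> and \<open>one\<close> of the underlying record play no role for modules.\<close>

definition quotient_space :: "(real, 'a) module \<Rightarrow> 'a set \<Rightarrow> (real, 'a set) module" where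
  "quotient_space M N = \<lparr>
     carrier = a_rcosets\<^bsub>M\<^esub> N,
     mult = undefined,
     one = undefined,
     zero = N,
     add = (\<lambda>A B. A <+>\<^bsub>M\<^esub> B),
     smult = (\<lambda>c A. \<Union>a\<in>A. N +>\<^bsub>M\<^esub> (c \<odot>\<^bsub>M\<^esub> a))\<rparr>"

text \<open>The direct sum of a family indexed by \<open>I\<close>; it is used for finite \<open>I\<close> only.\<close>

definition family_sum :: "'i set \<Rightarrow> ('i \<Rightarrow> (real, 'a) module) \<Rightarrow> (real, 'i \<Rightarrow> 'a) module" where
  "family_sum I M = \<lparr>
     carrier = (\<Pi>\<^sub>E i\<in>I. carrier (M i)),
     mult = undefined,
     one = undefined,
     zero = (\<lambda>i\<in>I. \<zero>\<^bsub>M i\<^esub>),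
     add = (\<lambda>f g. \<lambda>i\<in>I. f i \<oplus>\<^bsub>M i\<^esub> g i),
     smult = (\<lambda>c f. \<lambda>i\<in>I. c \<odot>\<^bsub>M i\<^esub> f i)\<rparr>"


section \<open>Sheaves on graphs and their cohomology\<close>

record ('x, 'i) graph =
  verts :: "'x set"
  edges :: "'i set"
  ends :: "'i \<Rightarrow> 'x set"

record ('x, 'i, 'a) graph_sheaf =
  vstalk :: "'x \<Rightarrow> (real, 'a) module"
  estalk :: "'i \<Rightarrow> (real, 'a) module"
  restr :: "'x \<Rightarrow> 'i \<Rightarrow> 'a \<Rightarrow> 'a"

text \<open>\<open>\<sigma> x i\<close> is the incidence number \<open>[x:i]\<close>.\<close>

definition incidence_signs :: "('x, 'i) graph \<Rightarrow> ('x \<Rightarrow> 'i \<Rightarrow> real) \<Rightarrow> bool" where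
  "incidence_signs G \<sigma> \<longleftrightarrow>
     (\<forall>i\<in>edges G. \<forall>x\<in>ends G i. \<sigma> x i \<in> {1, -1}) \<and>
     (\<forall>i\<in>edges G. \<forall>x\<in>ends G i. \<forall>y\<in>ends G i. x \<noteq> y \<longrightarrow> \<sigma> x i = - \<sigma> y i)"

definition cochains0 :: "('x, 'i) graph \<Rightarrow> ('x, 'i, 'a) graph_sheaf \<Rightarrow> (real, 'x \<Rightarrow> 'a) module" where
  "cochains0 G F = family_sum (verts G) (vstalk F)"

definition cochains1 :: "('x, 'i) graph \<Rightarrow> ('x, 'i, 'a) graph_sheaf \<Rightarrow> (real, 'i \<Rightarrow> 'a) module" where
  "cochains1 G F = family_sum (edges G) (estalk F)"

definition coboundary ::
  "('x, 'i) graph \<Rightarrow> ('x \<Rightarrow> 'i \<Rightarrow> real) \<Rightarrow> ('x, 'i, 'a) graph_sheaf \<Rightarrow> ('x \<Rightarrow> 'a) \<Rightarrow> ('i \<Rightarrow> 'a)" where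
  "coboundary G \<sigma> F w =
     (\<lambda>i\<in>edges G. \<Oplus>\<^bsub>estalk F i\<^esub>x\<in>ends G i. \<sigma> x i \<odot>\<^bsub>estalk F i\<^esub> restr F x i (w x))"

definition H0 ::
  "('x, 'i) graph \<Rightarrow> ('x \<Rightarrow> 'i \<Rightarrow> real) \<Rightarrow> ('x, 'i, 'a) graph_sheaf \<Rightarrow> (real, 'x \<Rightarrow> 'a) module" where
  "H0 G \<sigma> F = (cochains0 G F)
     \<lparr>carrier := mod_hom.ker (cochains0 G F) (cochains1 G F) (coboundary G \<sigma> F)\<rparr>"

definition H1 ::
  "('x, 'i) graph \<Rightarrow> ('x \<Rightarrow> 'i \<Rightarrow> real) \<Rightarrow> ('x, 'i, 'a) graph_sheaf \<Rightarrow> (real, ('i \<Rightarrow> 'a) set) module" where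
  "H1 G \<sigma> F = quotient_space (cochains1 G F) (mod_hom.im (cochains0 G F) (coboundary G \<sigma> F))"


section \<open>Motion sheaves on incidence graphs\<close>

text \<open>The edge joining the vertex \<open>v\<close> to the hyperedge \<open>e\<close> is the pair \<open>(v, e)\<close>.\<close>

definition incidence_graph :: "'v set \<Rightarrow> 'v set set \<Rightarrow> ('v + 'v set, 'v \<times> 'v set) graph" where
  "incidence_graph V E = \<lparr>
     verts = Inl ` V \<union> Inr ` E,
     edges = {(v, e). v \<in> V \<and> e \<in> E \<and> v \<in> e},
     ends = (\<lambda>(v, e). {Inl v, Inr e})\<rparr>"

text \<open>The intersection with the carrier only matters for the empty hyperedge, where the
  intersection of no subspaces is the whole space.\<close>

definition common_subspace :: "(real, 'b) module \<Rightarrow> ('v \<Rightarrow> 'b set) \<Rightarrow> 'v set \<Rightarrow> 'b set" where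
  "common_subspace \<V> S e = carrier \<V> \<inter> (\<Inter>u\<in>e. S u)"

text \<open>A coset \<open>x + \<Inter>S\<^sub>u\<close> is reduced modulo the larger space \<open>S\<^sub>v\<close> by adding \<open>S\<^sub>v\<close> to it
  as a set.\<close>

definition motion_sheaf ::
  "(real, 'b) module \<Rightarrow> ('v \<Rightarrow> 'b set) \<Rightarrow> ('v + 'v set, 'v \<times> 'v set, 'b set) graph_sheaf" where
  "motion_sheaf \<V> S = \<lparr>
     vstalk = (\<lambda>x. case x of
         Inl v \<Rightarrow> quotient_space \<V> (S v)
       | Inr e \<Rightarrow> quotient_space \<V> (common_subspace \<V> S e)),
     estalk = (\<lambda>(v, e). quotient_space \<V> (S v)),
     restr = (\<lambda>x (v, e). case x of
         Inl _ \<Rightarrow> (\<lambda>A. A)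
       | Inr _ \<Rightarrow> (\<lambda>A. A <+>\<^bsub>\<V>\<^esub> S v))\<rparr>"

definition h0 ::
  "'v set \<Rightarrow> 'v set set \<Rightarrow> ('v + 'v set \<Rightarrow> 'v \<times> 'v set \<Rightarrow> real) \<Rightarrow> (real, 'b) module
    \<Rightarrow> ('v \<Rightarrow> 'b set) \<Rightarrow> nat" where
  "h0 V E \<sigma> \<V> S = vdim (H0 (incidence_graph V E) \<sigma> (motion_sheaf \<V> S))"

definition h1 ::
  "'v set \<Rightarrow> 'v set set \<Rightarrow> ('v + 'v set \<Rightarrow> 'v \<times> 'v set \<Rightarrow> real) \<Rightarrow> (real, 'b) module
    \<Rightarrow> ('v \<Rightarrow> 'b set) \<Rightarrow> nat" where
  "h1 V E \<sigma> \<V> S = vdim (H1 (incidence_graph V E) \<sigma> (motion_sheaf \<V> S))"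


section \<open>The Grassmannian as a real algebraic variety\<close>

definition grassmannian :: "nat \<Rightarrow> (real, 'b) module \<Rightarrow> 'b set set" where
  "grassmannian s \<V> = {W. VectorSpace.subspace class_ring W \<V> \<and> vdim (\<V>\<lparr>carrier := W\<rparr>) = s}"

text \<open>A linear isomorphism onto \<open>\<real>\<^sup>n\<close>; the inner product on \<open>\<V>\<close> is the standard one of \<open>\<real>\<^sup>n\<close>
  transported along it.\<close>

definition linear_coordinates :: "nat \<Rightarrow> (real, 'b) module \<Rightarrow> ('b \<Rightarrow> real vec) \<Rightarrow> bool" where
  "linear_coordinates n \<V> \<phi> \<longleftrightarrow>
     linear_map class_ring \<V> (module_vec TYPE(real) n) \<phi> \<and>
     bij_betw \<phi> (carrier \<V>) (carrier_vec n)"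

definition projection_variety :: "nat \<Rightarrow> nat \<Rightarrow> real mat set" where
  "projection_variety n s =
     {P \<in> carrier_mat n n. transpose_mat P = P \<and> P * P = P \<and> (\<Sum>i<n. P $$ (i, i)) = real s}"

text \<open>The orthogonal projection onto \<open>W\<close>, as a point of the projection variety.\<close>

definition projection_of :: "nat \<Rightarrow> nat \<Rightarrow> ('b \<Rightarrow> real vec) \<Rightarrow> 'b set \<Rightarrow> real mat" where
  "projection_of n s \<phi> W =
     (THE P. P \<in> projection_variety n s \<and> (\<lambda>x. P *\<^sub>v x) ` carrier_vec n = \<phi> ` W)"

definition grassmannian_power :: "'v set \<Rightarrow> nat \<Rightarrow> (real, 'b) module \<Rightarrow> ('v \<Rightarrow> 'b set) set" where
  "grassmannian_power V s \<V> = (\<Pi>\<^sub>E v\<in>V. grassmannian s \<V>)"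

text \<open>The polynomial functions on the power of the Grassmannian indexed by \<open>V\<close>, that is, the
  polynomials in the entries of the projection matrices.\<close>

inductive grassmannian_poly ::
  "nat \<Rightarrow> nat \<Rightarrow> ('b \<Rightarrow> real vec) \<Rightarrow> 'v set \<Rightarrow> (('v \<Rightarrow> 'b set) \<Rightarrow> real) \<Rightarrow> bool"
  for n s \<phi> V where
  const: "grassmannian_poly n s \<phi> V (\<lambda>S. c)"
| entry: "v \<in> V \<Longrightarrow> i < n \<Longrightarrow> j < n \<Longrightarrow>
    grassmannian_poly n s \<phi> V (\<lambda>S. projection_of n s \<phi> (S v) $$ (i, j))"
| add: "grassmannian_poly n s \<phi> V p \<Longrightarrow> grassmannian_poly n s \<phi> V q \<Longrightarrow>
    grassmannian_poly n s \<phi> V (\<lambda>S. p S + q S)"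
| mult: "grassmannian_poly n s \<phi> V p \<Longrightarrow> grassmannian_poly n s \<phi> V q \<Longrightarrow>
    grassmannian_poly n s \<phi> V (\<lambda>S. p S * q S)"

text \<open>The closed sets are the common zero loci of arbitrary sets of polynomial functions.\<close>

definition zariski_topology ::
  "nat \<Rightarrow> nat \<Rightarrow> (real, 'b) module \<Rightarrow> ('b \<Rightarrow> real vec) \<Rightarrow> 'v set \<Rightarrow> ('v \<Rightarrow> 'b set) topology" where
  "zariski_topology n s \<V> \<phi> V = topology (\<lambda>W. \<exists>F. (\<forall>p\<in>F. grassmannian_poly n s \<phi> V p) \<and>
     W = grassmannian_power V s \<V> - {S \<in> grassmannian_power V s \<V>. \<forall>p\<in>F. p S = 0})"

text \<open>The semi-algebraic subsets are the Boolean combinations of the sets \<open>{p > 0}\<close>.\<close>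

inductive semialgebraic ::
  "nat \<Rightarrow> nat \<Rightarrow> (real, 'b) module \<Rightarrow> ('b \<Rightarrow> real vec) \<Rightarrow> 'v set \<Rightarrow> ('v \<Rightarrow> 'b set) set \<Rightarrow> bool"
  for n s \<V> \<phi> V where
  positive: "grassmannian_poly n s \<phi> V p \<Longrightarrow>
    semialgebraic n s \<V> \<phi> V {S \<in> grassmannian_power V s \<V>. p S > 0}"
| complement: "semialgebraic n s \<V> \<phi> V A \<Longrightarrow>
    semialgebraic n s \<V> \<phi> V (grassmannian_power V s \<V> - A)"
| union: "semialgebraic n s \<V> \<phi> V A \<Longrightarrow> semialgebraic n s \<V> \<phi> V B \<Longrightarrow>
    semialgebraic n s \<V> \<phi> V (A \<union> B)"

lemma openin_zariski_topology:
  "openin (zariski_topology n s \<V> \<phi> V) W \<longleftrightarrow> (\<exists>F. (\<forall>p\<in>F. grassmannian_poly n s \<phi> V p) \<and>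
     W = grassmannian_power V s \<V> - {S \<in> grassmannian_power V s \<V>. \<forall>p\<in>F. p S = 0})"
proof -
  define X where "X = grassmannian_power V s \<V>"
  define D where "D F = X - {S \<in> X. \<forall>p\<in>F. p S = 0}" for F :: "(('a \<Rightarrow> 'b set) \<Rightarrow> real) set"
  define Q where "Q F \<longleftrightarrow> (\<forall>p\<in>F. grassmannian_poly n s \<phi> V p)"
    for F :: "(('a \<Rightarrow> 'b set) \<Rightarrow> real) set"
  have D_iff: "S \<in> D F \<longleftrightarrow> S \<in> X \<and> (\<exists>p\<in>F. p S \<noteq> 0)" for S F
    by (auto simp: D_def)
  have inter: "\<exists>H. Q H \<and> A \<inter> B = D H" if "\<exists>F. Q F \<and> A = D F" "\<exists>F. Q F \<and> B = D F" for A B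
  proof -
    from that obtain F G where F: "Q F" "A = D F" and G: "Q G" "B = D G" by blast
    define H where "H = (\<lambda>(p, q) S. p S * q S) ` (F \<times> G)"
    have "Q H"
      using F(1) G(1) by (auto simp: Q_def H_def intro: grassmannian_poly.mult)
    moreover have "S \<in> A \<inter> B \<longleftrightarrow> S \<in> D H" for S
      unfolding F(2) G(2) Int_iff D_iff H_def by auto
    ultimately show ?thesis by (intro exI[of _ H]) auto
  qed
  have union: "\<exists>H. Q H \<and> \<Union>K = D H" if "\<forall>A\<in>K. \<exists>F. Q F \<and> A = D F" for K
  proof -
    from bchoice[OF that] obtain F where F: "\<forall>A\<in>K. Q (F A) \<and> A = D (F A)" by blast
    have "Q (\<Union>A\<in>K. F A)"
      using F by (auto simp: Q_def)
    moreover have "S \<in> \<Union>K \<longleftrightarrow> S \<in> D (\<Union>A\<in>K. F A)" for S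
    proof -
      have "S \<in> \<Union>K \<longleftrightarrow> (\<exists>A\<in>K. S \<in> D (F A))"
        using F by auto
      then show ?thesis by (auto simp: D_iff)
    qed
    ultimately show ?thesis by (intro exI[of _ "\<Union>A\<in>K. F A"]) auto
  qed
  have "istopology (\<lambda>W. \<exists>F. Q F \<and> W = D F)"
    unfolding istopology_def using inter union by (intro conjI allI impI) simp_all
  then have "openin (topology (\<lambda>W. \<exists>F. Q F \<and> W = D F)) W \<longleftrightarrow> (\<exists>F. Q F \<and> W = D F)"
    by (simp only: topology_inverse')
  then show ?thesis
    by (simp only: zariski_topology_def Q_def D_def X_def)
qed

lemma topspace_zariski_topology: "topspace (zariski_topology n s \<V> \<phi> V) = grassmannian_power V s \<V>"
proof
  show "topspace (zariski_topology n s \<V> \<phi> V) \<subseteq> grassmannian_power V s \<V>"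
    unfolding topspace_def openin_zariski_topology by blast
  have "openin (zariski_topology n s \<V> \<phi> V) (grassmannian_power V s \<V>)"
    unfolding openin_zariski_topology
    by (rule exI[of _ "{\<lambda>_. 1}"]) (auto intro: grassmannian_poly.const)
  then show "grassmannian_power V s \<V> \<subseteq> topspace (zariski_topology n s \<V> \<phi> V)"
    by (rule openin_subset)
qed


definition upper_semicontinuous :: "'x topology \<Rightarrow> ('x \<Rightarrow> int) \<Rightarrow> bool" where
  "upper_semicontinuous T f \<longleftrightarrow> (\<forall>a. openin T {x \<in> topspace T. f x < a})"

end

(* Let X be the space of families x of vectors of the ambient space indexed by the vertices of the
   incidence graph. The cochain spaces are quotients built from X, and the composite of X -> C0 with
   the coboundary d has image im d and kernel K(S), the families with
   [v:i] x_v + [e:i] x_e in S_v for every edge i = (v, e). Hence h0 = dim C0 - dim X + dim K(S) and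
   h1 = dim C1 - dim X + dim K(S), where dim C0 and dim C1 are constant on U by hypothesis.
   K(S) is the common kernel of the coordinates of (1 - P_v) ([v:i] x_v + [e:i] x_e), which are
   linear in x and polynomial in the entries of the projections P_v. So dim K(S) <= dim X - r holds
   iff some r vectors of X have a nonzero Gram determinant for the sum of the squares of these
   coordinates, and such a determinant is a polynomial function of S. *)

theory Submission
  imports Defs
begin

section \<open>Linear maps and quotients of real vector spaces\<close>

text \<open>The obstacle is that the stalks are quotients by subspaces that move with
  \<open>S\<close>. The coboundary has neither a fixed domain nor a fixed target, so its rank cannot
  be read off a matrix with entries polynomial in \<open>S\<close>. Starting from the fixed space
  \<open>X\<close> settles the domain: only a kernel inside \<open>X\<close> remains to be studied.
  The target is settled by reading "zero in V/S_v" as "killed by 1 - P_v", a map with values in the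
  fixed space R^n. The moving quotients then enter through their dimensions alone. Over the reals a
  sum of squares vanishes only if every term does. One Gram determinant therefore tests a tuple
  against all coordinates at once, and no rows have to be selected as for minors. Zariski open sets
  are defined by arbitrary families of polynomials, so all tuples of vectors of \<open>X\<close> may
  be used and no basis of \<open>X\<close> has to be fixed. On \<open>U\<close> both
  \<open>h0\<close> and \<open>h1\<close> differ from the same function dim K(S) by constants, hence
  a single open set serves both minima.\<close>

lemma linear_mapI:
  fixes M :: "(real, 'a) module" and N :: "(real, 'c) module"
  assumes "real_vectorspace M" "real_vectorspace N"
    and "\<And>x. x \<in> carrier M \<Longrightarrow> f x \<in> carrier N"
    and "\<And>x y. x \<in> carrier M \<Longrightarrow> y \<in> carrier M \<Longrightarrow> f (x \<oplus>\<^bsub>M\<^esub> y) = f x \<oplus>\<^bsub>N\<^esub> f y"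
    and "\<And>c x. x \<in> carrier M \<Longrightarrow> f (c \<odot>\<^bsub>M\<^esub> x) = c \<odot>\<^bsub>N\<^esub> f x"
  shows "linear_map class_ring M N f"
proof -
  interpret M: vectorspace class_ring M by fact
  interpret N: vectorspace class_ring N by fact
  have "f \<in> LinearCombinations.module_hom class_ring M N"
    unfolding LinearCombinations.module_hom_def using assms(3-5) by blast
  then show ?thesis
    by unfold_locales
qed

lemma linear_mapD:
  fixes M :: "(real, 'a) module" and N :: "(real, 'c) module"
  assumes "linear_map class_ring M N f"
  shows "real_vectorspace M" "real_vectorspace N"
    and "\<And>x. x \<in> carrier M \<Longrightarrow> f x \<in> carrier N"
    and "\<And>x y. x \<in> carrier M \<Longrightarrow> y \<in> carrier M \<Longrightarrow> f (x \<oplus>\<^bsub>M\<^esub> y) = f x \<oplus>\<^bsub>N\<^esub> f y"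
    and "\<And>c x. x \<in> carrier M \<Longrightarrow> f (c \<odot>\<^bsub>M\<^esub> x) = c \<odot>\<^bsub>N\<^esub> f x"
    and "f \<zero>\<^bsub>M\<^esub> = \<zero>\<^bsub>N\<^esub>"
proof -
  interpret linear_map class_ring M N f by fact
  show "real_vectorspace M" "real_vectorspace N" by unfold_locales
  show "\<And>x. x \<in> carrier M \<Longrightarrow> f x \<in> carrier N" by simp
  show "\<And>x y. x \<in> carrier M \<Longrightarrow> y \<in> carrier M \<Longrightarrow> f (x \<oplus>\<^bsub>M\<^esub> y) = f x \<oplus>\<^bsub>N\<^esub> f y" by simp
  show "\<And>c x. x \<in> carrier M \<Longrightarrow> f (c \<odot>\<^bsub>M\<^esub> x) = c \<odot>\<^bsub>N\<^esub> f x" by (simp add: class_ring_simps)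
  show "f \<zero>\<^bsub>M\<^esub> = \<zero>\<^bsub>N\<^esub>" by simp
qed

lemma linear_map_comp:
  fixes M :: "(real, 'a) module" and N :: "(real, 'c) module" and P :: "(real, 'd) module"
  assumes "linear_map class_ring M N f" "linear_map class_ring N P g"
  shows "linear_map class_ring M P (\<lambda>x. g (f x))"
  by (rule linear_mapI) (simp_all add: linear_mapD[OF assms(1)] linear_mapD[OF assms(2)])

text \<open>Every element of \<open>Q\<close> is some \<open>q x\<close>, so a law quantified over
  \<open>carrier Q\<close> is the image under \<open>q\<close> of the same law in \<open>M\<close>.
  This supplies the axioms for quotients, whose operations are given directly on cosets.\<close>

lemma vectorspace_surj_image:
  fixes M :: "(real, 'a) module" and Q :: "(real, 'c) module"
  assumes "real_vectorspace M" and surj: "q ` carrier M = carrier Q"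
    and add: "\<And>x y. x \<in> carrier M \<Longrightarrow> y \<in> carrier M \<Longrightarrow> q (x \<oplus>\<^bsub>M\<^esub> y) = q x \<oplus>\<^bsub>Q\<^esub> q y"
    and smult: "\<And>c x. x \<in> carrier M \<Longrightarrow> q (c \<odot>\<^bsub>M\<^esub> x) = c \<odot>\<^bsub>Q\<^esub> q x"
    and zero: "q \<zero>\<^bsub>M\<^esub> = \<zero>\<^bsub>Q\<^esub>"
  shows "real_vectorspace Q"
proof -
  interpret M: vectorspace class_ring M by fact
  have all: "(\<forall>y\<in>carrier Q. P y) \<longleftrightarrow> (\<forall>x\<in>carrier M. P (q x))" for P
    using surj by (metis imageE imageI)
  have ex: "(\<exists>y\<in>carrier Q. P y) \<longleftrightarrow> (\<exists>x\<in>carrier M. P (q x))" for P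
    using surj by (metis imageE imageI)
  have im: "q x \<in> carrier Q" if "x \<in> carrier M" for x using that surj by blast
  have sc: "c \<odot>\<^bsub>M\<^esub> x \<in> carrier M" if "x \<in> carrier M" for c x
    using that M.smult_closed by (simp add: class_ring_simps)
  have [simp]: "(a + b) \<odot>\<^bsub>M\<^esub> x = a \<odot>\<^bsub>M\<^esub> x \<oplus>\<^bsub>M\<^esub> b \<odot>\<^bsub>M\<^esub> x"
    "(a * b) \<odot>\<^bsub>M\<^esub> x = a \<odot>\<^bsub>M\<^esub> (b \<odot>\<^bsub>M\<^esub> x)" "1 \<odot>\<^bsub>M\<^esub> x = x"
    "a \<odot>\<^bsub>M\<^esub> (x \<oplus>\<^bsub>M\<^esub> y) = a \<odot>\<^bsub>M\<^esub> x \<oplus>\<^bsub>M\<^esub> a \<odot>\<^bsub>M\<^esub> y"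
    if "x \<in> carrier M" "y \<in> carrier M" for a b x y
    using that M.smult_l_distr[of a b x] M.smult_assoc1[of a b x] M.smult_one[of x] M.smult_r_distr[of a x y]
    by (simp_all add: class_ring_simps)
  show ?thesis
  proof (rule vs_criteria, goal_cases)
    case 1 show ?case by (rule class_field)
  next
    case 2 show ?case using im zero M.zero_closed by metis
  next
    case 3
    have "\<forall>v\<in>carrier Q. \<forall>w\<in>carrier Q. v \<oplus>\<^bsub>Q\<^esub> w \<in> carrier Q"
      unfolding all by (simp add: add[symmetric] im)
    then show ?case by blast
  next
    case 4
    show ?case unfolding all ex
    proof
      fix x assume "x \<in> carrier M"
      then show "\<exists>xa\<in>carrier M. q x \<oplus>\<^bsub>Q\<^esub> q xa = \<zero>\<^bsub>Q\<^esub>"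
        by (intro bexI[of _ "\<ominus>\<^bsub>M\<^esub> x"]) (simp_all add: add[symmetric] zero M.r_neg)
    qed
  next
    case 5
    have "\<forall>c. \<forall>v\<in>carrier Q. c \<odot>\<^bsub>Q\<^esub> v \<in> carrier Q"
      unfolding all by (simp add: smult[symmetric] im sc)
    then show ?case by blast
  next
    case 6
    have "\<forall>v\<in>carrier Q. \<forall>w\<in>carrier Q. v \<oplus>\<^bsub>Q\<^esub> w = w \<oplus>\<^bsub>Q\<^esub> v"
      unfolding all by (simp add: add[symmetric] M.a_comm)
    then show ?case by blast
  next
    case 7
    have "\<forall>v\<in>carrier Q. \<forall>w\<in>carrier Q. \<forall>u\<in>carrier Q. v \<oplus>\<^bsub>Q\<^esub> w \<oplus>\<^bsub>Q\<^esub> u = v \<oplus>\<^bsub>Q\<^esub> (w \<oplus>\<^bsub>Q\<^esub> u)"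
      unfolding all by (simp add: add[symmetric] M.a_assoc)
    then show ?case by blast
  next
    case 8
    show ?case unfolding all by (simp add: zero[symmetric] add[symmetric])
  next
    case 9
    have "\<forall>a b. \<forall>v\<in>carrier Q. (a * b) \<odot>\<^bsub>Q\<^esub> v = a \<odot>\<^bsub>Q\<^esub> (b \<odot>\<^bsub>Q\<^esub> v)"
      unfolding all by (simp add: smult[symmetric] sc)
    then show ?case by (simp add: class_ring_simps)
  next
    case 10
    show ?case unfolding all by (simp add: smult[symmetric] class_ring_simps)
  next
    case 11
    have "\<forall>a b. \<forall>v\<in>carrier Q. (a + b) \<odot>\<^bsub>Q\<^esub> v = a \<odot>\<^bsub>Q\<^esub> v \<oplus>\<^bsub>Q\<^esub> b \<odot>\<^bsub>Q\<^esub> v"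
      unfolding all by (simp add: smult[symmetric] add[symmetric] sc)
    then show ?case by (simp add: class_ring_simps)
  next
    case 12
    have "\<forall>a. \<forall>v\<in>carrier Q. \<forall>w\<in>carrier Q. a \<odot>\<^bsub>Q\<^esub> (v \<oplus>\<^bsub>Q\<^esub> w) = a \<odot>\<^bsub>Q\<^esub> v \<oplus>\<^bsub>Q\<^esub> a \<odot>\<^bsub>Q\<^esub> w"
      unfolding all by (simp add: smult[symmetric] add[symmetric] sc)
    then show ?case by (simp add: class_ring_simps)
  qed
qed

text \<open>Independence does not depend on the ambient space, so an independent subset of
  \<open>N\<close> has at most dim M elements; a maximal one is then a finite basis of
  \<open>N\<close>.\<close>

lemma subspace_fin_dim:
  fixes M :: "(real, 'a) module"
  assumes "real_vectorspace M" "vectorspace.fin_dim class_ring M" "VectorSpace.subspace class_ring N M"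
  shows "vectorspace.fin_dim class_ring (M\<lparr>carrier := N\<rparr>)"
proof -
  interpret M: vectorspace class_ring M by fact
  interpret N: vectorspace class_ring "M\<lparr>carrier := N\<rparr>"
    by (rule M.subspace_is_vs) fact
  have sub: "submodule class_ring N M" using assms(3) by (simp add: VectorSpace.subspace_def)
  then have NM: "N \<subseteq> carrier M" by (simp add: submodule_def)
  let ?P = "\<lambda>A. A \<subseteq> carrier (M\<lparr>carrier := N\<rparr>) \<and> \<not> N.lin_dep A"
  have bound: "finite A \<and> card A \<le> M.dim" if "?P A" for A
    using that M.li_le_dim[OF assms(2), of A] M.span_li_not_depend(2)[OF _ sub, of A] NM by auto
  have "?P {}" by (simp add: N.lin_dep_def)
  from maximal_exists[where P="?P", OF bound this] obtain A where "finite A" "maximal A ?P" by blast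
  then show ?thesis
    using N.max_li_is_basis[of A] by (auto simp: N.basis_def N.fin_dim_def)
qed

text \<open>All reals lie in the carrier of \<open>class_ring\<close>, so the module laws hold with
  ordinary real arithmetic and without premises on scalars. In this form they serve as rewrite
  rules.\<close>

lemma real_vectorspace_smult:
  fixes M :: "(real, 'a) module"
  assumes "real_vectorspace M"
  shows "\<And>c x. x \<in> carrier M \<Longrightarrow> c \<odot>\<^bsub>M\<^esub> x \<in> carrier M"
    and "\<And>a b x. x \<in> carrier M \<Longrightarrow> (a + b) \<odot>\<^bsub>M\<^esub> x = a \<odot>\<^bsub>M\<^esub> x \<oplus>\<^bsub>M\<^esub> b \<odot>\<^bsub>M\<^esub> x"
    and "\<And>a x y. x \<in> carrier M \<Longrightarrow> y \<in> carrier M \<Longrightarrow> a \<odot>\<^bsub>M\<^esub> (x \<oplus>\<^bsub>M\<^esub> y) = a \<odot>\<^bsub>M\<^esub> x \<oplus>\<^bsub>M\<^esub> a \<odot>\<^bsub>M\<^esub> y"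
    and "\<And>a b x. x \<in> carrier M \<Longrightarrow> (a * b) \<odot>\<^bsub>M\<^esub> x = a \<odot>\<^bsub>M\<^esub> (b \<odot>\<^bsub>M\<^esub> x)"
    and "\<And>x. x \<in> carrier M \<Longrightarrow> 1 \<odot>\<^bsub>M\<^esub> x = x"
    and "\<And>a. a \<odot>\<^bsub>M\<^esub> \<zero>\<^bsub>M\<^esub> = \<zero>\<^bsub>M\<^esub>"
    and "\<And>x. x \<in> carrier M \<Longrightarrow> 0 \<odot>\<^bsub>M\<^esub> x = \<zero>\<^bsub>M\<^esub>"
proof -
  interpret M: vectorspace class_ring M by fact
  show "\<And>c x. x \<in> carrier M \<Longrightarrow> c \<odot>\<^bsub>M\<^esub> x \<in> carrier M"
    using M.smult_closed by (simp add: class_ring_simps)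
  show "\<And>a b x. x \<in> carrier M \<Longrightarrow> (a + b) \<odot>\<^bsub>M\<^esub> x = a \<odot>\<^bsub>M\<^esub> x \<oplus>\<^bsub>M\<^esub> b \<odot>\<^bsub>M\<^esub> x"
    using M.smult_l_distr by (simp add: class_ring_simps)
  show "\<And>a x y. x \<in> carrier M \<Longrightarrow> y \<in> carrier M \<Longrightarrow> a \<odot>\<^bsub>M\<^esub> (x \<oplus>\<^bsub>M\<^esub> y) = a \<odot>\<^bsub>M\<^esub> x \<oplus>\<^bsub>M\<^esub> a \<odot>\<^bsub>M\<^esub> y"
    using M.smult_r_distr by (simp add: class_ring_simps)
  show "\<And>a b x. x \<in> carrier M \<Longrightarrow> (a * b) \<odot>\<^bsub>M\<^esub> x = a \<odot>\<^bsub>M\<^esub> (b \<odot>\<^bsub>M\<^esub> x)"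
    using M.smult_assoc1 by (simp add: class_ring_simps)
  show "\<And>x. x \<in> carrier M \<Longrightarrow> 1 \<odot>\<^bsub>M\<^esub> x = x"
    using M.smult_one by (simp add: class_ring_simps)
  show "\<And>a. a \<odot>\<^bsub>M\<^esub> \<zero>\<^bsub>M\<^esub> = \<zero>\<^bsub>M\<^esub>"
    using M.rmult_0 by (simp add: class_ring_simps)
  show "\<And>x. x \<in> carrier M \<Longrightarrow> 0 \<odot>\<^bsub>M\<^esub> x = \<zero>\<^bsub>M\<^esub>"
    using M.lmult_0 by (simp add: class_ring_simps)
qed

lemma real_rank_nullity:
  fixes M :: "(real, 'a) module" and N :: "(real, 'c) module"
  assumes "linear_map class_ring M N f" "vectorspace.fin_dim class_ring M"
  shows "vdim (N\<lparr>carrier := f ` carrier M\<rparr>) + vdim (M\<lparr>carrier := {x \<in> carrier M. f x = \<zero>\<^bsub>N\<^esub>}\<rparr>)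
    = vdim M"
proof -
  interpret linear_map class_ring M N f by fact
  show ?thesis using rank_nullity[OF assms(2)] by (simp add: im_def ker_def)
qed

lemma subspace_abelian_subgroup:
  fixes M :: "(real, 'a) module"
  assumes "real_vectorspace M" "VectorSpace.subspace class_ring N M"
  shows "abelian_subgroup N M"
proof -
  interpret M: vectorspace class_ring M by fact
  interpret N: submodule class_ring N M using assms(2) by (simp add: VectorSpace.subspace_def)
  have "\<ominus>\<^bsub>M\<^esub> x \<in> N" if "x \<in> N" for x
  proof -
    have "- 1 \<odot>\<^bsub>M\<^esub> x \<in> N"
      using that by (simp add: class_ring_simps)
    moreover have "- 1 \<odot>\<^bsub>M\<^esub> x = \<ominus>\<^bsub>M\<^esub> x"
      using M.smult_minus_1[OF subsetD[OF N.subset that]] by (simp add: class_ring_simps)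
    ultimately show ?thesis by metis
  qed
  then have "subgroup N (add_monoid M)"
    using N.subset by (intro subgroup.intro) (auto simp: a_inv_def)
  then show ?thesis
    by (intro abelian_subgroupI3 additive_subgroupI M.M.abelian_group_axioms)
qed

lemma quotient_space:
  fixes M :: "(real, 'a) module"
  assumes M: "real_vectorspace M" and N: "VectorSpace.subspace class_ring N M"
  shows quotient_space_vectorspace: "real_vectorspace (quotient_space M N)"
    and quotient_projection_linear: "linear_map class_ring M (quotient_space M N) (\<lambda>x. N +>\<^bsub>M\<^esub> x)"
    and quotient_projection_surj: "(\<lambda>x. N +>\<^bsub>M\<^esub> x) ` carrier M = carrier (quotient_space M N)"
    and quotient_projection_zero: "x \<in> carrier M \<Longrightarrow> N +>\<^bsub>M\<^esub> x = \<zero>\<^bsub>quotient_space M N\<^esub> \<longleftrightarrow> x \<in> N"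
proof -
  interpret M: vectorspace class_ring M by fact
  interpret N: submodule class_ring N M using assms(2) by (simp add: VectorSpace.subspace_def)
  interpret A: abelian_subgroup N M by (rule subspace_abelian_subgroup) fact+
  show surj: "(\<lambda>x. N +>\<^bsub>M\<^esub> x) ` carrier M = carrier (quotient_space M N)"
    by (auto simp: quotient_space_def A_RCOSETS_def' )
  have add: "N +>\<^bsub>M\<^esub> (x \<oplus>\<^bsub>M\<^esub> y) = (N +>\<^bsub>M\<^esub> x) \<oplus>\<^bsub>quotient_space M N\<^esub> (N +>\<^bsub>M\<^esub> y)"
    if "x \<in> carrier M" "y \<in> carrier M" for x y
    using that by (simp add: quotient_space_def A.a_rcos_sum)
  have smult: "N +>\<^bsub>M\<^esub> (c \<odot>\<^bsub>M\<^esub> x) = c \<odot>\<^bsub>quotient_space M N\<^esub> (N +>\<^bsub>M\<^esub> x)"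
    if x: "x \<in> carrier M" for c x
  proof -
    \<comment> \<open>A scalar multiple of a coset is a union over its representatives
      \<open>a\<close>. All the cosets united coincide, because representatives differ by elements
      of \<open>N\<close> and \<open>c\<close> maps \<open>N\<close> into itself; the union equals
      that common coset because a coset is nonempty.\<close>
    have "N +>\<^bsub>M\<^esub> (c \<odot>\<^bsub>M\<^esub> a) = N +>\<^bsub>M\<^esub> (c \<odot>\<^bsub>M\<^esub> x)" if "a \<in> N +>\<^bsub>M\<^esub> x" for a
    proof -
      from that obtain h where h: "h \<in> N" "a = h \<oplus>\<^bsub>M\<^esub> x" by (auto simp: a_r_coset_def')
      then have "c \<odot>\<^bsub>M\<^esub> a = c \<odot>\<^bsub>M\<^esub> h \<oplus>\<^bsub>M\<^esub> c \<odot>\<^bsub>M\<^esub> x"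
        using x N.subset by (auto simp: real_vectorspace_smult[OF M])
      moreover have "c \<odot>\<^bsub>M\<^esub> h \<in> N" using h N.smult_closed[of c h] by (simp add: class_ring_simps)
      ultimately have "c \<odot>\<^bsub>M\<^esub> a \<in> N +>\<^bsub>M\<^esub> (c \<odot>\<^bsub>M\<^esub> x)" by (auto simp: a_r_coset_def')
      from M.a_repr_independence[OF this] show ?thesis
        using x A.a_subgroup by (simp add: real_vectorspace_smult[OF M])
    qed
    then have "(\<Union>a\<in>N +>\<^bsub>M\<^esub> x. N +>\<^bsub>M\<^esub> (c \<odot>\<^bsub>M\<^esub> a)) = (\<Union>a\<in>N +>\<^bsub>M\<^esub> x. N +>\<^bsub>M\<^esub> (c \<odot>\<^bsub>M\<^esub> x))"
      by (intro SUP_cong refl)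
    moreover have "N +>\<^bsub>M\<^esub> x \<noteq> {}" using A.a_rcos_self[OF x] by blast
    ultimately show ?thesis by (simp add: quotient_space_def)
  qed
  have zero: "N +>\<^bsub>M\<^esub> \<zero>\<^bsub>M\<^esub> = \<zero>\<^bsub>quotient_space M N\<^esub>"
    using N.subset by (simp add: quotient_space_def)
  show vs: "real_vectorspace (quotient_space M N)"
    by (rule vectorspace_surj_image[OF M surj add smult zero])
  show "linear_map class_ring M (quotient_space M N) (\<lambda>x. N +>\<^bsub>M\<^esub> x)"
    using surj by (intro linear_mapI M vs add smult) auto
  show "N +>\<^bsub>M\<^esub> x = \<zero>\<^bsub>quotient_space M N\<^esub> \<longleftrightarrow> x \<in> N" if x: "x \<in> carrier M"
    using A.a_rcos_self[OF x] A.a_rcos_const[of x] by (auto simp: quotient_space_def)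
qed

text \<open>Rank-nullity for the projection, whose kernel is \<open>N\<close> and whose image is
  everything. The additive form avoids truncated subtraction.\<close>

lemma quotient_space_dim:
  fixes M :: "(real, 'a) module"
  assumes "real_vectorspace M" "vectorspace.fin_dim class_ring M" "VectorSpace.subspace class_ring N M"
  shows "vectorspace.fin_dim class_ring (quotient_space M N)"
    and "vdim (quotient_space M N) + vdim (M\<lparr>carrier := N\<rparr>) = vdim M"
proof -
  interpret p: linear_map class_ring M "quotient_space M N" "\<lambda>x. N +>\<^bsub>M\<^esub> x"
    by (rule quotient_projection_linear[OF assms(1,3)])
  note surj = quotient_projection_surj[OF assms(1,3)]
  show "vectorspace.fin_dim class_ring (quotient_space M N)"
    by (rule p.surj_fin_dim[OF assms(2) surj])
  have "N \<subseteq> carrier M" using assms(3) by (simp add: VectorSpace.subspace_def submodule_def)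
  then have ker: "{x \<in> carrier M. N +>\<^bsub>M\<^esub> x = \<zero>\<^bsub>quotient_space M N\<^esub>} = N"
    using quotient_projection_zero[OF assms(1,3)] by auto
  show "vdim (quotient_space M N) + vdim (M\<lparr>carrier := N\<rparr>) = vdim M"
    using real_rank_nullity[OF p.linear_map_axioms assms(2)] unfolding surj ker by simp
qed

lemma linear_map_image_kernel:
  fixes M :: "(real, 'a) module" and N :: "(real, 'c) module"
  assumes "linear_map class_ring M N f"
  shows "VectorSpace.subspace class_ring (f ` carrier M) N"
    and "VectorSpace.subspace class_ring {x \<in> carrier M. f x = \<zero>\<^bsub>N\<^esub>} M"
proof -
  interpret linear_map class_ring M N f by fact
  show "VectorSpace.subspace class_ring (f ` carrier M) N"
    using imT_is_subspace by (simp add: im_def)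
  show "VectorSpace.subspace class_ring {x \<in> carrier M. f x = \<zero>\<^bsub>N\<^esub>} M"
    using kerT_is_subspace by (simp add: ker_def)
qed

lemma linear_map_injI:
  fixes M :: "(real, 'a) module" and N :: "(real, 'c) module"
  assumes "linear_map class_ring M N f"
    and "\<And>x. x \<in> carrier M \<Longrightarrow> f x = \<zero>\<^bsub>N\<^esub> \<Longrightarrow> x = \<zero>\<^bsub>M\<^esub>"
  shows "inj_on f (carrier M)"
proof -
  interpret linear_map class_ring M N f by fact
  show ?thesis by (rule Ke0_imp_inj) (use assms(2) in \<open>auto simp: ker_def\<close>)
qed

lemma linear_map_inj_dim_le:
  fixes M :: "(real, 'a) module" and N :: "(real, 'c) module"
  assumes f: "linear_map class_ring M N f" and "vectorspace.fin_dim class_ring M"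
    "vectorspace.fin_dim class_ring N" and inj: "inj_on f (carrier M)"
  shows "vdim M \<le> vdim N"
proof -
  interpret linear_map class_ring M N f by fact
  have "vdim M = vdim (N\<lparr>carrier := f ` carrier M\<rparr>)"
    using rank_nullity[OF assms(2)] inj_imp_dim_ker0[OF inj] by (simp add: im_def)
  then show ?thesis
    using quotient_space_dim(2)[OF linear_mapD(2)[OF f] assms(3) linear_map_image_kernel(1)[OF f]] by simp
qed

lemma linear_map_bij_dim:
  fixes M :: "(real, 'a) module" and N :: "(real, 'c) module"
  assumes f: "linear_map class_ring M N f" and "vectorspace.fin_dim class_ring M"
    and bij: "bij_betw f (carrier M) (carrier N)"
  shows "vectorspace.fin_dim class_ring N" and "vdim N = vdim M"
proof -
  interpret linear_map class_ring M N f by fact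
  have "inj_on f (carrier M)" "f ` carrier M = carrier N" using bij by (auto simp: bij_betw_def)
  then show "vectorspace.fin_dim class_ring N" "vdim N = vdim M"
    using surj_fin_dim[OF assms(2)] dim_eq[OF assms(2)] by auto
qed

section \<open>Coordinates and direct sums\<close>

lemma module_vec_real:
  shows "real_vectorspace (module_vec TYPE(real) r)"
    and "vectorspace.fin_dim class_ring (module_vec TYPE(real) r)"
    and "vdim (module_vec TYPE(real) r) = r"
proof -
  interpret vec_space "TYPE(real)" r .
  show "real_vectorspace (module_vec TYPE(real) r)" by (rule vec_vs)
  show "vectorspace.fin_dim class_ring (module_vec TYPE(real) r)" by (rule fin_dim)
  show "vdim (module_vec TYPE(real) r) = r" by (rule dim_is_n)
qed

lemma linear_map_finsum:
  fixes M :: "(real, 'a) module" and N :: "(real, 'c) module"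
  assumes f: "linear_map class_ring M N f" and "\<And>a. a \<in> A \<Longrightarrow> g a \<in> carrier M"
  shows "f (\<Oplus>\<^bsub>M\<^esub>a\<in>A. g a) = (\<Oplus>\<^bsub>N\<^esub>a\<in>A. f (g a))"
proof -
  interpret M: vectorspace class_ring M by (rule linear_mapD(1)[OF f])
  interpret N: vectorspace class_ring N by (rule linear_mapD(2)[OF f])
  have "g \<in> A \<rightarrow> carrier M" using assms(2) by blast
  then show ?thesis
  proof (induction A rule: infinite_finite_induct)
    case (insert a A)
    then have g: "g a \<in> carrier M" "g \<in> A \<rightarrow> carrier M" by auto
    then have "(\<lambda>x. f (g x)) \<in> A \<rightarrow> carrier N" by (auto simp: Pi_iff linear_mapD[OF f])
    with g show ?case using insert.hyps insert.IH
      by (simp add: linear_mapD[OF f] M.M.finsum_insert N.M.finsum_insert)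
  qed (auto simp: linear_mapD[OF f])
qed

lemma linear_functional_finsum:
  fixes M :: "(real, 'a) module" and l :: "'a \<Rightarrow> real"
  assumes "real_vectorspace M" and "\<And>a. a \<in> A \<Longrightarrow> g a \<in> carrier M"
    and "\<And>x y. x \<in> carrier M \<Longrightarrow> y \<in> carrier M \<Longrightarrow> l (x \<oplus>\<^bsub>M\<^esub> y) = l x + l y"
    and "l \<zero>\<^bsub>M\<^esub> = 0"
  shows "l (\<Oplus>\<^bsub>M\<^esub>a\<in>A. g a) = (\<Sum>a\<in>A. l (g a))"
proof -
  interpret M: vectorspace class_ring M by fact
  have "g \<in> A \<rightarrow> carrier M" using assms(2) by blast
  then show ?thesis
  proof (induction A rule: infinite_finite_induct)
    case (insert a A)
    then have "g a \<in> carrier M" "g \<in> A \<rightarrow> carrier M" by auto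
    with insert show ?case
      by (simp add: M.M.finsum_insert assms(3))
  qed (auto simp: assms(4))
qed

text \<open>Vectors are indexed by numbers instead of being collected in a set: a tuple may then
  contain repetitions, and the coefficients form a \<open>vec\<close> on which matrices act.\<close>

definition comb :: "(real, 'a) module \<Rightarrow> nat \<Rightarrow> (nat \<Rightarrow> 'a) \<Rightarrow> real vec \<Rightarrow> 'a" where
  "comb M r x c = (\<Oplus>\<^bsub>M\<^esub>a\<in>{..<r}. c $ a \<odot>\<^bsub>M\<^esub> x a)"

lemma comb_linear:
  fixes M :: "(real, 'a) module"
  assumes M: "real_vectorspace M" and x: "\<And>a. a < r \<Longrightarrow> x a \<in> carrier M"
  shows "linear_map class_ring (module_vec TYPE(real) r) M (comb M r x)"
proof (rule linear_mapI[OF module_vec_real(1) M])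
  interpret M: vectorspace class_ring M by fact
  have sc: "(\<lambda>a. c $ a \<odot>\<^bsub>M\<^esub> x a) \<in> {..<r} \<rightarrow> carrier M" for c :: "real vec"
    using x by (auto simp: real_vectorspace_smult[OF M])
  show "comb M r x c \<in> carrier M" for c :: "real vec"
    unfolding comb_def by (rule M.M.finsum_closed[OF sc])
  show "comb M r x (c \<oplus>\<^bsub>module_vec TYPE(real) r\<^esub> d) = comb M r x c \<oplus>\<^bsub>M\<^esub> comb M r x d"
    if "c \<in> carrier (module_vec TYPE(real) r)" "d \<in> carrier (module_vec TYPE(real) r)" for c d
  proof -
    have "comb M r x (c + d) = (\<Oplus>\<^bsub>M\<^esub>a\<in>{..<r}. c $ a \<odot>\<^bsub>M\<^esub> x a \<oplus>\<^bsub>M\<^esub> d $ a \<odot>\<^bsub>M\<^esub> x a)"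
      unfolding comb_def using that x
      by (intro M.M.finsum_cong') (auto simp: module_vec_simps real_vectorspace_smult[OF M])
    also have "\<dots> = comb M r x c \<oplus>\<^bsub>M\<^esub> comb M r x d"
      unfolding comb_def by (rule M.M.finsum_addf[OF sc sc])
    finally show ?thesis by (simp add: module_vec_simps)
  qed
  show "comb M r x (k \<odot>\<^bsub>module_vec TYPE(real) r\<^esub> c) = k \<odot>\<^bsub>M\<^esub> comb M r x c"
    if "c \<in> carrier (module_vec TYPE(real) r)" for k c
  proof -
    have "k \<odot>\<^bsub>M\<^esub> comb M r x c = (\<Oplus>\<^bsub>M\<^esub>a\<in>{..<r}. k \<odot>\<^bsub>M\<^esub> (c $ a \<odot>\<^bsub>M\<^esub> x a))"
      unfolding comb_def by (rule M.finsum_smult[OF _ sc]) (simp add: class_ring_simps)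
    also have "\<dots> = comb M r x (k \<cdot>\<^sub>v c)"
      unfolding comb_def using that x
      by (intro M.M.finsum_cong') (auto simp: module_vec_simps real_vectorspace_smult[OF M])
    finally show ?thesis by (simp add: module_vec_simps)
  qed
qed

lemma linear_map_comb:
  fixes M :: "(real, 'a) module" and N :: "(real, 'c) module"
  assumes f: "linear_map class_ring M N f" and x: "\<And>a. a < r \<Longrightarrow> x a \<in> carrier M"
  shows "f (comb M r x c) = comb N r (\<lambda>a. f (x a)) c"
proof -
  interpret N: vectorspace class_ring N by (rule linear_mapD(2)[OF f])
  show ?thesis
    unfolding comb_def using x
    by (subst linear_map_finsum[OF f])
      (auto intro!: N.M.finsum_cong' simp: linear_mapD[OF f] real_vectorspace_smult[OF linear_mapD(1)[OF f]]
         real_vectorspace_smult[OF linear_mapD(2)[OF f]])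
qed

lemma basis_tuple_exists:
  fixes M :: "(real, 'a) module"
  assumes M: "real_vectorspace M" and fd: "vectorspace.fin_dim class_ring M"
  obtains x where "\<And>a. a < vdim M \<Longrightarrow> x a \<in> carrier M"
    and "bij_betw (comb M (vdim M) x) (carrier_vec (vdim M)) (carrier M)"
proof -
  interpret M: vectorspace class_ring M by fact
  from M.finite_basis_exists[OF fd] obtain B where B: "finite B" "M.basis B" by blast
  define r where "r = vdim M"
  have BM: "B \<subseteq> carrier M" and r: "card B = r"
    using B M.dim_basis[OF B] by (auto simp: M.basis_def r_def)
  obtain x where x: "bij_betw x {..<r} B"
    using ex_bij_betw_nat_finite[OF B(1)] by (auto simp: r atLeast0LessThan)
  have xM: "x a \<in> carrier M" if "a < r" for a using x BM that by (auto simp: bij_betw_def)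
  have xB: "x ` {..<r} = B" "inj_on x {..<r}" using x by (auto simp: bij_betw_def)
  have lc: "M.lincomb k B = comb M r x (vec r (\<lambda>a. k (x a)))" for k
  proof -
    have "M.lincomb k B = (\<Oplus>\<^bsub>M\<^esub>a\<in>{..<r}. k (x a) \<odot>\<^bsub>M\<^esub> x a)"
      unfolding M.lincomb_def xB(1)[symmetric]
      by (rule M.M.finsum_reindex[OF _ xB(2)]) (use xM in \<open>auto simp: real_vectorspace_smult[OF M]\<close>)
    also have "\<dots> = comb M r x (vec r (\<lambda>a. k (x a)))"
      unfolding comb_def using xM by (intro M.M.finsum_cong') (auto simp: real_vectorspace_smult[OF M])
    finally show ?thesis .
  qed
  interpret T: linear_map class_ring "module_vec TYPE(real) r" M "comb M r x"
    by (rule comb_linear[OF M xM])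
  have inj: "inj_on (comb M r x) (carrier (module_vec TYPE(real) r))"
  proof (rule linear_map_injI[OF T.linear_map_axioms])
    fix c assume c: "c \<in> carrier (module_vec TYPE(real) r)" and 0: "comb M r x c = \<zero>\<^bsub>M\<^esub>"
    \<comment> \<open>Independence of \<open>B\<close> concerns coefficient functions on
      \<open>B\<close>; \<open>k\<close> transports the coefficient vector \<open>c\<close> there
      along the inverse of the enumeration \<open>x\<close>.\<close>
    define k where "k b = c $ (the_inv_into {..<r} x b)" for b
    have kx: "k (x a) = c $ a" if "a < r" for a
      using that xB(2) by (simp add: k_def the_inv_into_f_f)
    have "vec r (\<lambda>a. k (x a)) = c" using c kx by (intro eq_vecI) (auto simp: module_vec_simps)
    with 0 have "M.lincomb k B = \<zero>\<^bsub>M\<^esub>" by (simp add: lc)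
    then have "k \<in> B \<rightarrow> {0}"
      using M.not_lindepD[of B B k] B by (auto simp: M.basis_def class_ring_simps)
    then have "c $ a = 0" if "a < r" for a
      using kx[OF that] that xB(1) by (metis Pi_mem imageI lessThan_iff singletonD)
    then show "c = \<zero>\<^bsub>module_vec TYPE(real) r\<^esub>" using c by (intro eq_vecI) (auto simp: module_vec_simps)
  qed
  have "y \<in> comb M r x ` carrier_vec r" if "y \<in> carrier M" for y
  proof -
    have "y \<in> M.span B" using that B(2) by (simp add: M.basis_def)
    from M.finite_in_span[OF B(1) BM this] obtain k where "M.lincomb k B = y" by blast
    then show ?thesis unfolding lc by auto
  qed
  then have "bij_betw (comb M r x) (carrier_vec r) (carrier M)"
    using inj T.T_im by (auto simp: bij_betw_def module_vec_simps)
  with xM that show ?thesis unfolding r_def by blast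
qed

section \<open>Direct sums of finite families\<close>

lemma family_sum_vectorspace:
  fixes M :: "'i \<Rightarrow> (real, 'a) module"
  assumes "\<And>i. i \<in> I \<Longrightarrow> real_vectorspace (M i)"
  shows "real_vectorspace (family_sum I M)"
proof -
  have ab: "abelian_group (M i)" if "i \<in> I" for i
    using assms[OF that] by (simp add: vectorspace_def Module.module_def)
  note [simp] = abelian_groupE(1,2)[OF ab] real_vectorspace_smult[OF assms]
  show ?thesis
  proof (rule vs_criteria, goal_cases)
    case 1 show ?case by (rule class_field)
  next
    case 4
    show ?case
    proof
      fix v assume v: "v \<in> carrier (family_sum I M)"
      then have "v i \<oplus>\<^bsub>M i\<^esub> (\<ominus>\<^bsub>M i\<^esub> v i) = \<zero>\<^bsub>M i\<^esub>" "\<ominus>\<^bsub>M i\<^esub> v i \<in> carrier (M i)" if "i \<in> I" for i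
        using that abelian_group.r_neg[OF ab[OF that], of "v i"] abelian_group.a_inv_closed[OF ab[OF that], of "v i"]
        by (auto simp: family_sum_def PiE_iff)
      then show "\<exists>w\<in>carrier (family_sum I M). v \<oplus>\<^bsub>family_sum I M\<^esub> w = \<zero>\<^bsub>family_sum I M\<^esub>"
        by (intro bexI[of _ "\<lambda>i\<in>I. \<ominus>\<^bsub>M i\<^esub> v i"]) (auto simp: family_sum_def fun_eq_iff)
    qed
  next
    case 6
    show ?case
      by (auto simp: family_sum_def fun_eq_iff PiE_iff abelian_groupE(4)[OF ab])
  next
    case 7
    show ?case
      by (auto simp: family_sum_def fun_eq_iff PiE_iff abelian_groupE(3)[OF ab])
  next
    case 8
    show ?case
      by (auto simp: family_sum_def fun_eq_iff PiE_iff extensional_def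
          abelian_monoid.r_zero[OF abelian_group.axioms(1)[OF ab]])
  qed (auto simp: family_sum_def fun_eq_iff PiE_iff extensional_def class_ring_simps)
qed

text \<open>By induction on \<open>I\<close>, a coordinate vector is split in two: its leading
  entries are coordinates in the new summand, its trailing entries are coordinates in the sum over
  the old indices. An isomorphism with R^t yields finite dimension and the dimension
  together.\<close>

lemma family_sum_coordinates:
  fixes M :: "'i \<Rightarrow> (real, 'a) module"
  assumes "finite I" "\<And>i. i \<in> I \<Longrightarrow> real_vectorspace (M i)"
    and "\<And>i. i \<in> I \<Longrightarrow> vectorspace.fin_dim class_ring (M i)"
  shows "\<exists>T. linear_map class_ring (module_vec TYPE(real) (\<Sum>i\<in>I. vdim (M i))) (family_sum I M) T \<and>
    bij_betw T (carrier_vec (\<Sum>i\<in>I. vdim (M i))) (carrier (family_sum I M))"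
  using assms
proof (induction I)
  case empty
  \<comment> \<open>R^0 has a single vector, and the empty sum has a single element, the function
    that is \<open>undefined\<close> everywhere.\<close>
  have "linear_map class_ring (module_vec TYPE(real) 0) (family_sum {} M) (\<lambda>_ _. undefined)"
    by (intro linear_mapI module_vec_real family_sum_vectorspace) (auto simp: family_sum_def)
  moreover have "carrier_vec 0 = {0\<^sub>v 0 :: real vec}" by auto
  ultimately show ?case
    by (intro exI[of _ "\<lambda>_ _. undefined"]) (auto simp: family_sum_def bij_betw_def)
next
  case (insert i I)
  define r where "r = vdim (M i)"
  define t where "t = (\<Sum>i\<in>I. vdim (M i))"
  let ?J = "insert i I"
  from insert obtain T where T: "linear_map class_ring (module_vec TYPE(real) t) (family_sum I M) T"
      "bij_betw T (carrier_vec t) (carrier (family_sum I M))"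
    unfolding t_def by auto
  have Mi: "real_vectorspace (M i)" "vectorspace.fin_dim class_ring (M i)" using insert.prems by auto
  obtain x where x: "\<And>a. a < r \<Longrightarrow> x a \<in> carrier (M i)"
      and bij: "bij_betw (comb (M i) r x) (carrier_vec r) (carrier (M i))"
    using basis_tuple_exists[OF Mi] unfolding r_def by blast
  define R where "R = comb (M i) r x"
  have R: "linear_map class_ring (module_vec TYPE(real) r) (M i) R" "bij_betw R (carrier_vec r) (carrier (M i))"
    unfolding R_def by (rule comb_linear[OF Mi(1) x]) (use bij in simp_all)
  note Rl = linear_mapD[OF R(1), unfolded module_vec_simps] and Tl = linear_mapD[OF T(1), unfolded module_vec_simps]
  define F where "F c = (\<lambda>j\<in>?J. if j = i then R (vec_first c r) else T (vec_last c t) j)" for c :: "real vec"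
  have first: "vec_first (c + d) r = vec_first c r + vec_first d r"
      "vec_first (k \<cdot>\<^sub>v c) r = k \<cdot>\<^sub>v vec_first c r"
      "vec_last (c + d) t = vec_last c t + vec_last d t" "vec_last (k \<cdot>\<^sub>v c) t = k \<cdot>\<^sub>v vec_last c t"
    if "c \<in> carrier_vec (r + t)" "d \<in> carrier_vec (r + t)" for c d :: "real vec" and k
    using that by (auto simp: vec_first_def vec_last_def Let_def)
  have Tc: "T c j \<in> carrier (M j)" if "c \<in> carrier_vec t" "j \<in> I" for c j
    using Tl(3)[OF that(1)] that(2) by (auto simp: family_sum_def)
  have "linear_map class_ring (module_vec TYPE(real) (r + t)) (family_sum ?J M) F"
  proof (intro linear_mapI module_vec_real family_sum_vectorspace)
    show "F c \<in> carrier (family_sum ?J M)" for c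
      using Rl(3) Tc by (auto simp: family_sum_def F_def)
    show "F (c \<oplus>\<^bsub>module_vec TYPE(real) (r + t)\<^esub> d) = F c \<oplus>\<^bsub>family_sum ?J M\<^esub> F d"
      if "c \<in> carrier (module_vec TYPE(real) (r + t))" "d \<in> carrier (module_vec TYPE(real) (r + t))" for c d
      using that by (auto simp: module_vec_simps F_def first Rl(4) Tl(4) fun_eq_iff family_sum_def)
    show "F (k \<odot>\<^bsub>module_vec TYPE(real) (r + t)\<^esub> c) = k \<odot>\<^bsub>family_sum ?J M\<^esub> F c"
      if "c \<in> carrier (module_vec TYPE(real) (r + t))" for c k
      using that by (auto simp: module_vec_simps F_def first Rl(5) Tl(5) fun_eq_iff family_sum_def)
  qed (use insert.prems in auto)
  moreover have "bij_betw F (carrier_vec (r + t)) (carrier (family_sum ?J M))"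
    unfolding bij_betw_def
  proof
    show "inj_on F (carrier_vec (r + t))"
    proof (rule inj_onI)
      fix c d assume c: "c \<in> carrier_vec (r + t)" and d: "d \<in> carrier_vec (r + t)" and eq: "F c = F d"
      from fun_cong[OF eq, of i] have "R (vec_first c r) = R (vec_first d r)" by (simp add: F_def)
      then have 1: "vec_first c r = vec_first d r"
        using R(2) by (auto simp: bij_betw_def dest: inj_onD)
      \<comment> \<open>On \<open>I\<close> these functions agree with \<open>F c\<close> and
        \<open>F d\<close>, because the new index \<open>i\<close> is not in \<open>I\<close>; off
        \<open>I\<close> both are \<open>undefined\<close> by extensionality.\<close>
      have "T (vec_last c t) = T (vec_last d t)"
      proof
        fix j
        show "T (vec_last c t) j = T (vec_last d t) j"
      proof (cases "j \<in> I")
        case True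
        then show ?thesis using fun_cong[OF eq, of j] insert.hyps by (auto simp: F_def split: if_splits)
      next
        case False
        then show ?thesis using Tl(3)[of "vec_last c t"] Tl(3)[of "vec_last d t"]
          by (auto simp: family_sum_def PiE_iff extensional_def)
        qed
      qed
      then have "vec_last c t = vec_last d t"
        using bij_betw_imp_inj_on[OF T(2)] by (auto dest!: inj_onD)
      with 1 show "c = d" using vec_first_last_append[OF c] vec_first_last_append[OF d] by metis
    qed
    have "f \<in> F ` carrier_vec (r + t)" if f: "f \<in> carrier (family_sum ?J M)" for f
    proof -
      have "f i \<in> carrier (M i)" "restrict f I \<in> carrier (family_sum I M)"
        using f by (auto simp: family_sum_def)
      then obtain c d where cd: "c \<in> carrier_vec r" "R c = f i" "d \<in> carrier_vec t" "T d = restrict f I"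
        using R(2) T(2) by (auto simp: bij_betw_def) (metis imageE)
      have "vec_first (c @\<^sub>v d) r = c" "vec_last (c @\<^sub>v d) t = d"
        using cd by (auto simp: vec_first_def vec_last_def)
      then have "F (c @\<^sub>v d) = f"
        using cd f by (auto simp: F_def fun_eq_iff family_sum_def PiE_iff extensional_def)
      moreover have "c @\<^sub>v d \<in> carrier_vec (r + t)" using cd by simp
      ultimately show ?thesis by blast
    qed
    moreover have "F c \<in> carrier (family_sum ?J M)" for c
      using Rl(3) Tc by (auto simp: family_sum_def F_def)
    ultimately show "F ` carrier_vec (r + t) = carrier (family_sum ?J M)" by blast
  qed
  ultimately show ?case
    using insert.hyps by (auto simp: r_def t_def)
qed

lemma family_sum_dim:
  fixes M :: "'i \<Rightarrow> (real, 'a) module"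
  assumes "finite I" "\<And>i. i \<in> I \<Longrightarrow> real_vectorspace (M i)"
    and "\<And>i. i \<in> I \<Longrightarrow> vectorspace.fin_dim class_ring (M i)"
  shows "vectorspace.fin_dim class_ring (family_sum I M)"
    and "vdim (family_sum I M) = (\<Sum>i\<in>I. vdim (M i))"
proof -
  from family_sum_coordinates[of I M] assms obtain T where
    T: "linear_map class_ring (module_vec TYPE(real) (\<Sum>i\<in>I. vdim (M i))) (family_sum I M) T"
    "bij_betw T (carrier_vec (\<Sum>i\<in>I. vdim (M i))) (carrier (family_sum I M))"
    by blast
  show "vectorspace.fin_dim class_ring (family_sum I M)"
    and "vdim (family_sum I M) = (\<Sum>i\<in>I. vdim (M i))"
    using linear_map_bij_dim[OF T(1) module_vec_real(2)] T(2) by (simp_all add: module_vec_simps module_vec_real)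
qed

section \<open>The coboundary of a motion sheaf\<close>

text \<open>Arguments of \<open>d\<close> are lifted along the surjection \<open>q\<close>, and the
  linearity of \<open>t\<close> is pushed down. The coboundary becomes linear in this way without a
  computation with sums of cosets.\<close>

lemma linear_map_factor:
  fixes X :: "(real, 'a) module" and C :: "(real, 'c) module" and D :: "(real, 'd) module"
  assumes q: "linear_map class_ring X C q" and surj: "q ` carrier X = carrier C"
    and t: "linear_map class_ring X D t" and dq: "\<And>x. x \<in> carrier X \<Longrightarrow> d (q x) = t x"
  shows "linear_map class_ring C D d"
proof (rule linear_mapI[OF linear_mapD(2)[OF q] linear_mapD(2)[OF t]])
  note qs = linear_mapD[OF q] and ts = linear_mapD[OF t]
  interpret X: vectorspace class_ring X by (rule qs(1))
  show "d y \<in> carrier D" if y: "y \<in> carrier C" for y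
  proof -
    obtain x where "x \<in> carrier X" "q x = y" using surj y by (metis imageE)
    then show ?thesis using dq ts(3) by metis
  qed
  show "d (y \<oplus>\<^bsub>C\<^esub> z) = d y \<oplus>\<^bsub>D\<^esub> d z" if y: "y \<in> carrier C" and z: "z \<in> carrier C" for y z
  proof -
    obtain x where x: "x \<in> carrier X" "q x = y" using surj y by (metis imageE)
    obtain w where w: "w \<in> carrier X" "q w = z" using surj z by (metis imageE)
    have "d (y \<oplus>\<^bsub>C\<^esub> z) = t (x \<oplus>\<^bsub>X\<^esub> w)"
      using dq[OF X.M.a_closed[OF x(1) w(1)]] qs(4)[OF x(1) w(1)] x(2) w(2) by simp
    then show ?thesis using ts(4)[OF x(1) w(1)] dq x w by metis
  qed
  show "d (k \<odot>\<^bsub>C\<^esub> y) = k \<odot>\<^bsub>D\<^esub> d y" if y: "y \<in> carrier C" for k y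
  proof -
    obtain x where x: "x \<in> carrier X" "q x = y" using surj y by (metis imageE)
    have "d (k \<odot>\<^bsub>C\<^esub> y) = t (k \<odot>\<^bsub>X\<^esub> x)"
      using dq[OF real_vectorspace_smult(1)[OF qs(1) x(1)]] qs(5)[OF x(1)] x(2) by simp
    then show ?thesis using ts(5)[OF x(1)] dq x by metis
  qed
qed

text \<open>Since N + S = S, adding \<open>S\<close> enlarges the coset and keeps the
  representative. This identifies the restriction map from a hyperedge stalk with reduction of
  representatives.\<close>

lemma coset_add_subspace:
  fixes M :: "(real, 'a) module"
  assumes M: "real_vectorspace M" and N: "VectorSpace.subspace class_ring N M"
    and S: "VectorSpace.subspace class_ring S M" and NS: "N \<subseteq> S" and x: "x \<in> carrier M"
  shows "(N +>\<^bsub>M\<^esub> x) <+>\<^bsub>M\<^esub> S = S +>\<^bsub>M\<^esub> x"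
proof -
  interpret M: vectorspace class_ring M by fact
  have N0: "\<zero>\<^bsub>M\<^esub> \<in> N" and SM: "s \<in> S \<Longrightarrow> s \<in> carrier M"
    and Sadd: "s \<in> S \<Longrightarrow> h \<in> S \<Longrightarrow> s \<oplus>\<^bsub>M\<^esub> h \<in> S" for s h
    using N S by (auto simp: VectorSpace.subspace_def submodule_def)
  have "h \<oplus>\<^bsub>M\<^esub> x \<oplus>\<^bsub>M\<^esub> s = (h \<oplus>\<^bsub>M\<^esub> s) \<oplus>\<^bsub>M\<^esub> x" if "h \<in> S" "s \<in> S" for h s
    using that SM x by (simp add: M.M.a_ac)
  note hs = this
  have coset: "y \<in> T +>\<^bsub>M\<^esub> x \<longleftrightarrow> (\<exists>h\<in>T. y = h \<oplus>\<^bsub>M\<^esub> x)" for T y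
    unfolding a_r_coset_def' by blast
  have sum: "y \<in> A <+>\<^bsub>M\<^esub> B \<longleftrightarrow> (\<exists>a\<in>A. \<exists>b\<in>B. y = a \<oplus>\<^bsub>M\<^esub> b)" for A B y
    unfolding set_add_def' by blast
  show ?thesis
  proof (intro equalityI subsetI)
    fix y assume "y \<in> (N +>\<^bsub>M\<^esub> x) <+>\<^bsub>M\<^esub> S"
    then obtain h s where h: "h \<in> S" "s \<in> S" "y = h \<oplus>\<^bsub>M\<^esub> x \<oplus>\<^bsub>M\<^esub> s"
      unfolding sum Bex_def coset using NS by blast
    then show "y \<in> S +>\<^bsub>M\<^esub> x"
      unfolding coset using hs Sadd by blast
  next
    fix y assume "y \<in> S +>\<^bsub>M\<^esub> x"
    then obtain s where s: "s \<in> S" "y = s \<oplus>\<^bsub>M\<^esub> x" unfolding coset by blast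
    then have "y = \<zero>\<^bsub>M\<^esub> \<oplus>\<^bsub>M\<^esub> x \<oplus>\<^bsub>M\<^esub> s"
      using SM[OF s(1)] x by (simp add: M.M.a_comm)
    then show "y \<in> (N +>\<^bsub>M\<^esub> x) <+>\<^bsub>M\<^esub> S"
      unfolding sum Bex_def coset using s N0 by blast
  qed
qed

section \<open>The cochain complex of a motion sheaf, lifted to families of vectors\<close>

locale incidence_data =
  fixes V :: "'v set" and E :: "'v set set" and \<V> :: "(real, 'b) module"
    and \<sigma> :: "'v + 'v set \<Rightarrow> 'v \<times> 'v set \<Rightarrow> real"
  assumes finite_V: "finite V" and E_sub: "E \<subseteq> Pow V"
    and vs: "real_vectorspace \<V>" and fd: "vectorspace.fin_dim class_ring \<V>"
begin

sublocale \<V>: vectorspace class_ring \<V> by (rule vs)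

abbreviation G where "G \<equiv> incidence_graph V E"

text \<open>The cochains of degree 0 and 1 are quotients of spaces of families of vectors of \<open>\<V>\<close>
  that do not depend on the subspaces. On these families the coboundary is the map \<open>lift\<close>.\<close>

definition families :: "(real, 'v + 'v set \<Rightarrow> 'b) module" where
  "families = family_sum (verts G) (\<lambda>_. \<V>)"

definition lift :: "('v + 'v set \<Rightarrow> 'b) \<Rightarrow> 'v \<times> 'v set \<Rightarrow> 'b" where
  "lift x i = \<sigma> (Inl (fst i)) i \<odot>\<^bsub>\<V>\<^esub> x (Inl (fst i)) \<oplus>\<^bsub>\<V>\<^esub> \<sigma> (Inr (snd i)) i \<odot>\<^bsub>\<V>\<^esub> x (Inr (snd i))"

definition vertex_space :: "('v \<Rightarrow> 'b set) \<Rightarrow> 'v + 'v set \<Rightarrow> 'b set" where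
  "vertex_space S = case_sum S (common_subspace \<V> S)"

text \<open>When the \<open>S v\<close> are subspaces, this is the preimage of \<open>H0\<close>
  under the projection of \<open>families\<close> onto the 0-cochains, a subspace of a space that
  does not depend on \<open>S\<close>.\<close>

definition motions :: "('v \<Rightarrow> 'b set) \<Rightarrow> ('v + 'v set \<Rightarrow> 'b) set" where
  "motions S = {x \<in> carrier families. \<forall>i\<in>edges G. lift x i \<in> S (fst i)}"

lemma finite_G: "finite (verts G)" "finite (edges G)"
proof -
  have "finite E" using E_sub finite_V by (meson finite_Pow_iff finite_subset)
  moreover have "edges G \<subseteq> V \<times> E" by (auto simp: incidence_graph_def)
  ultimately show "finite (verts G)" "finite (edges G)"
    using finite_V by (auto simp: incidence_graph_def intro: finite_subset)
qed

lemma edgesE: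
  assumes "i \<in> edges G"
  obtains v e where "i = (v, e)" "v \<in> V" "e \<in> E" "v \<in> e" "Inl v \<in> verts G" "Inr e \<in> verts G"
  using assms by (auto simp: incidence_graph_def)

lemma families_vectorspace: "real_vectorspace families"
  unfolding families_def by (rule family_sum_vectorspace[OF vs])

lemma families_fin_dim: "vectorspace.fin_dim class_ring families"
  unfolding families_def by (rule family_sum_dim(1)[OF finite_G(1) vs fd])

lemma families_closed: "x \<in> carrier families \<Longrightarrow> z \<in> verts G \<Longrightarrow> x z \<in> carrier \<V>"
  by (auto simp: families_def family_sum_def)

lemma lift_linear:
  assumes i: "i \<in> edges G"
  shows "linear_map class_ring families \<V> (\<lambda>x. lift x i)"
proof (rule linear_mapI[OF families_vectorspace vs])
  obtain v e where z: "i = (v, e)" "Inl v \<in> verts G" "Inr e \<in> verts G" using edgesE[OF i] by metis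
  note sm = real_vectorspace_smult[OF vs]
  have [simp]: "\<sigma> z j \<odot>\<^bsub>\<V>\<^esub> (k \<odot>\<^bsub>\<V>\<^esub> w) = k \<odot>\<^bsub>\<V>\<^esub> (\<sigma> z j \<odot>\<^bsub>\<V>\<^esub> w)" if "w \<in> carrier \<V>" for z j k w
    using that by (simp flip: sm(4) add: mult.commute)
  show "lift x i \<in> carrier \<V>" if "x \<in> carrier families" for x
    using families_closed[OF that] z by (simp add: lift_def sm)
  show "lift (x \<oplus>\<^bsub>families\<^esub> y) i = lift x i \<oplus>\<^bsub>\<V>\<^esub> lift y i"
    if "x \<in> carrier families" "y \<in> carrier families" for x y
    using families_closed[OF that(1)] families_closed[OF that(2)] z
    by (simp add: lift_def families_def family_sum_def sm \<V>.M.a_ac)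
  show "lift (k \<odot>\<^bsub>families\<^esub> x) i = k \<odot>\<^bsub>\<V>\<^esub> lift x i" if "x \<in> carrier families" for k x
    using families_closed[OF that] z
    by (simp add: lift_def families_def family_sum_def sm)
qed

context
  fixes S :: "'v \<Rightarrow> 'b set"
  assumes S: "\<And>v. v \<in> V \<Longrightarrow> VectorSpace.subspace class_ring (S v) \<V>"
begin

abbreviation "\<M> \<equiv> motion_sheaf \<V> S"
abbreviation "C0 \<equiv> cochains0 G \<M>"
abbreviation "C1 \<equiv> cochains1 G \<M>"

lemma common_subspace:
  assumes "e \<subseteq> V"
  shows "VectorSpace.subspace class_ring (common_subspace \<V> S e) \<V>"
proof -
  have "submodule class_ring (S u) \<V>" if "u \<in> e" for u
    using S assms that by (auto simp: VectorSpace.subspace_def)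
  then have "submodule class_ring (common_subspace \<V> S e) \<V>"
    by (intro submodule.intro \<V>.module_axioms)
      (auto simp: common_subspace_def submodule_def class_ring_simps real_vectorspace_smult[OF vs])
  then show ?thesis by (simp add: VectorSpace.subspace_def vs)
qed

lemma vertex_subspace:
  assumes "z \<in> verts G"
  shows "VectorSpace.subspace class_ring (vertex_space S z) \<V>"
  using assms S common_subspace E_sub
  by (auto simp: vertex_space_def incidence_graph_def)

lemma edge_subspace: "i \<in> edges G \<Longrightarrow> VectorSpace.subspace class_ring (S (fst i)) \<V>"
  using S by (auto simp: incidence_graph_def)

lemma stalks:
  "vstalk \<M> z = quotient_space \<V> (vertex_space S z)"
  "estalk \<M> i = quotient_space \<V> (S (fst i))"
  by (auto simp: motion_sheaf_def vertex_space_def split: sum.splits prod.splits)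

lemma cochains_vectorspace: "real_vectorspace C0" "real_vectorspace C1"
  unfolding cochains0_def cochains1_def
  by (intro family_sum_vectorspace; simp add: stalks quotient_space_vectorspace[OF vs]
      vertex_subspace edge_subspace)+

text \<open>The stalks are quotients of \<open>\<V>\<close>, and dimensions add up over a direct
  sum. The differences of natural numbers are exact, as a subspace has dimension at most dim \<V>.
  Only the dimensions of the subspaces appear, which is what lets the constancy hypothesis
  act.\<close>

lemma cochains_dim:
  "vectorspace.fin_dim class_ring C0" "vectorspace.fin_dim class_ring C1"
  "vdim C0 = (\<Sum>z\<in>verts G. vdim \<V> - vdim (\<V>\<lparr>carrier := vertex_space S z\<rparr>))"
  "vdim C1 = (\<Sum>i\<in>edges G. vdim \<V> - vdim (\<V>\<lparr>carrier := S (fst i)\<rparr>))"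
proof -
  note v = quotient_space_vectorspace[OF vs] and q = quotient_space_dim(1)[OF vs fd]
  have d: "vdim (quotient_space \<V> N) = vdim \<V> - vdim (\<V>\<lparr>carrier := N\<rparr>)"
    if "VectorSpace.subspace class_ring N \<V>" for N
    using quotient_space_dim(2)[OF vs fd that] by simp
  show "vectorspace.fin_dim class_ring C0"
    unfolding cochains0_def by (rule family_sum_dim(1)[OF finite_G(1)]) (simp_all add: stalks v q vertex_subspace)
  show "vectorspace.fin_dim class_ring C1"
    unfolding cochains1_def by (rule family_sum_dim(1)[OF finite_G(2)]) (simp_all add: stalks v q edge_subspace)
  have "vdim C0 = (\<Sum>z\<in>verts G. vdim (vstalk \<M> z))"
    unfolding cochains0_def by (rule family_sum_dim(2)[OF finite_G(1)]) (simp_all add: stalks v q vertex_subspace)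
  then show "vdim C0 = (\<Sum>z\<in>verts G. vdim \<V> - vdim (\<V>\<lparr>carrier := vertex_space S z\<rparr>))"
    by (simp add: stalks d vertex_subspace)
  have "vdim C1 = (\<Sum>z\<in>edges G. vdim (estalk \<M> z))"
    unfolding cochains1_def by (rule family_sum_dim(2)[OF finite_G(2)]) (simp_all add: stalks v q edge_subspace)
  then show "vdim C1 = (\<Sum>i\<in>edges G. vdim \<V> - vdim (\<V>\<lparr>carrier := S (fst i)\<rparr>))"
    by (simp add: stalks d edge_subspace)
qed

definition class0 :: "('v + 'v set \<Rightarrow> 'b) \<Rightarrow> 'v + 'v set \<Rightarrow> 'b set" where
  "class0 x = (\<lambda>z\<in>verts G. vertex_space S z +>\<^bsub>\<V>\<^esub> x z)"

definition class1 :: "('v \<times> 'v set \<Rightarrow> 'b) \<Rightarrow> 'v \<times> 'v set \<Rightarrow> 'b set" where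
  "class1 y = (\<lambda>i\<in>edges G. S (fst i) +>\<^bsub>\<V>\<^esub> y i)"

lemma class0_linear: "linear_map class_ring families C0 class0"
proof (rule linear_mapI[OF families_vectorspace cochains_vectorspace(1)])
  note p = linear_mapD[OF quotient_projection_linear[OF vs vertex_subspace]]
  show "class0 x \<in> carrier C0" if "x \<in> carrier families" for x
    using p(3) families_closed[OF that] by (auto simp: class0_def cochains0_def family_sum_def stalks)
  show "class0 (x \<oplus>\<^bsub>families\<^esub> y) = class0 x \<oplus>\<^bsub>C0\<^esub> class0 y"
    if "x \<in> carrier families" "y \<in> carrier families" for x y
    using p(4) families_closed[OF that(1)] families_closed[OF that(2)]
    by (auto simp: class0_def cochains0_def family_sum_def stalks families_def fun_eq_iff)
  show "class0 (k \<odot>\<^bsub>families\<^esub> x) = k \<odot>\<^bsub>C0\<^esub> class0 x" if "x \<in> carrier families" for k x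
    using p(5) families_closed[OF that]
    by (auto simp: class0_def cochains0_def family_sum_def stalks families_def fun_eq_iff)
qed

lemma class0_surj: "class0 ` carrier families = carrier C0"
proof
  show "class0 ` carrier families \<subseteq> carrier C0" using linear_mapD(3)[OF class0_linear] by blast
  show "carrier C0 \<subseteq> class0 ` carrier families"
  proof
    fix w assume w: "w \<in> carrier C0"
    have "\<forall>z\<in>verts G. \<exists>a. a \<in> carrier \<V> \<and> vertex_space S z +>\<^bsub>\<V>\<^esub> a = w z"
    proof
      fix z assume z: "z \<in> verts G"
      then have "w z \<in> carrier (quotient_space \<V> (vertex_space S z))"
        using w by (auto simp: cochains0_def family_sum_def stalks)
      then show "\<exists>a. a \<in> carrier \<V> \<and> vertex_space S z +>\<^bsub>\<V>\<^esub> a = w z"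
        unfolding quotient_projection_surj[OF vs vertex_subspace[OF z], symmetric] by blast
    qed
    from bchoice[OF this] obtain x where
      x: "\<forall>z\<in>verts G. x z \<in> carrier \<V> \<and> vertex_space S z +>\<^bsub>\<V>\<^esub> x z = w z" by blast
    then have "restrict x (verts G) \<in> carrier families" "class0 (restrict x (verts G)) = w"
      using w by (auto simp: families_def family_sum_def class0_def cochains0_def PiE_iff extensional_def fun_eq_iff)
    then show "w \<in> class0 ` carrier families" by blast
  qed
qed

lemma class1_lift_linear: "linear_map class_ring families C1 (\<lambda>x. class1 (lift x))"
proof (rule linear_mapI[OF families_vectorspace cochains_vectorspace(2)])
  note p = linear_mapD[OF quotient_projection_linear[OF vs edge_subspace]] and l = linear_mapD[OF lift_linear]
  show "class1 (lift x) \<in> carrier C1" if "x \<in> carrier families" for x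
    using p(3) l(3) that by (auto simp: class1_def cochains1_def family_sum_def stalks)
  show "class1 (lift (x \<oplus>\<^bsub>families\<^esub> y)) = class1 (lift x) \<oplus>\<^bsub>C1\<^esub> class1 (lift y)"
    if "x \<in> carrier families" "y \<in> carrier families" for x y
    using p(4) l(3,4) that
    by (auto simp: class1_def cochains1_def family_sum_def stalks fun_eq_iff)
  show "class1 (lift (k \<odot>\<^bsub>families\<^esub> x)) = k \<odot>\<^bsub>C1\<^esub> class1 (lift x)" if "x \<in> carrier families" for k x
    using p(5) l(3,5) that
    by (auto simp: class1_def cochains1_def family_sum_def stalks fun_eq_iff)
qed

lemma class1_lift_zero:
  assumes "x \<in> carrier families"
  shows "class1 (lift x) = \<zero>\<^bsub>C1\<^esub> \<longleftrightarrow> (\<forall>i\<in>edges G. lift x i \<in> S (fst i))"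
proof -
  have "class1 (lift x) = \<zero>\<^bsub>C1\<^esub> \<longleftrightarrow>
      (\<forall>i\<in>edges G. S (fst i) +>\<^bsub>\<V>\<^esub> lift x i = \<zero>\<^bsub>quotient_space \<V> (S (fst i))\<^esub>)"
    by (auto simp: class1_def cochains1_def family_sum_def stalks fun_eq_iff)
  also have "\<dots> \<longleftrightarrow> (\<forall>i\<in>edges G. lift x i \<in> S (fst i))"
    using quotient_projection_zero[OF vs edge_subspace] linear_mapD(3)[OF lift_linear] assms by auto
  finally show ?thesis .
qed

text \<open>At an edge (v, e) both restriction maps land in the quotient by \<open>S v\<close> and
  keep the representatives \<open>x (Inl v)\<close> and \<open>x (Inr e)\<close>: the one is the
  identity, the other enlarges the coset. The signed sum of the two classes is the class of the
  signed sum, by linearity of the projection.\<close>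

lemma coboundary_class0:
  assumes x: "x \<in> carrier families"
  shows "coboundary G \<sigma> \<M> (class0 x) = class1 (lift x)"
proof
  fix i
  show "coboundary G \<sigma> \<M> (class0 x) i = class1 (lift x) i"
  proof (cases "i \<in> edges G")
    case False
    then show ?thesis by (simp add: coboundary_def class1_def)
  next
    case i: True
    then obtain v e where z: "i = (v, e)" "v \<in> V" "e \<in> E" "v \<in> e" "Inl v \<in> verts G" "Inr e \<in> verts G"
      using edgesE by metis
    let ?Q = "quotient_space \<V> (S v)"
    have Sv: "VectorSpace.subspace class_ring (S v) \<V>" using S z by blast
    note p = linear_mapD[OF quotient_projection_linear[OF vs Sv]]
    interpret Q: vectorspace class_ring ?Q by (rule p(2))
    have xv: "x (Inl v) \<in> carrier \<V>" "x (Inr e) \<in> carrier \<V>" using families_closed x z by auto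
    have "common_subspace \<V> S e \<subseteq> S v" using z by (auto simp: common_subspace_def)
    then have red: "(common_subspace \<V> S e +>\<^bsub>\<V>\<^esub> x (Inr e)) <+>\<^bsub>\<V>\<^esub> S v = S v +>\<^bsub>\<V>\<^esub> x (Inr e)"
      using z E_sub by (intro coset_add_subspace[OF vs _ Sv _ xv(2)] common_subspace) auto
    have "coboundary G \<sigma> \<M> (class0 x) i =
        (\<Oplus>\<^bsub>?Q\<^esub>y\<in>{Inl v, Inr e}. \<sigma> y i \<odot>\<^bsub>?Q\<^esub> (S v +>\<^bsub>\<V>\<^esub> x y))"
      unfolding coboundary_def using i xv z red p(3)
      by (auto simp: stalks class0_def vertex_space_def motion_sheaf_def incidence_graph_def
          real_vectorspace_smult[OF p(2)] intro!: Q.M.finsum_cong')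
    also have "\<dots> = \<sigma> (Inl v) i \<odot>\<^bsub>?Q\<^esub> (S v +>\<^bsub>\<V>\<^esub> x (Inl v)) \<oplus>\<^bsub>?Q\<^esub> \<sigma> (Inr e) i \<odot>\<^bsub>?Q\<^esub> (S v +>\<^bsub>\<V>\<^esub> x (Inr e))"
      using xv p(3) by (simp add: Q.M.finsum_insert real_vectorspace_smult[OF p(2)])
    also have "\<dots> = S v +>\<^bsub>\<V>\<^esub> lift x i"
      using xv z by (simp add: lift_def p(4,5) real_vectorspace_smult[OF vs])
    finally show ?thesis using i z by (simp add: class1_def)
  qed
qed

lemma coboundary_linear: "linear_map class_ring C0 C1 (coboundary G \<sigma> \<M>)"
  by (rule linear_map_factor[where X = families and q = class0 and t = "\<lambda>x. class1 (lift x)"])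
    (simp_all add: class0_linear class0_surj class1_lift_linear coboundary_class0)

text \<open>The rank of the coboundary is eliminated from three counts: rank-nullity for the
  coboundary, rank-nullity for its composite with the surjection \<open>class0\<close>, which has
  the same image, and the dimension of the cokernel.\<close>

lemma cohomology_dim:
  "h0 V E \<sigma> \<V> S + vdim families = vdim C0 + vdim (families\<lparr>carrier := motions S\<rparr>)"
  "h1 V E \<sigma> \<V> S + vdim families = vdim C1 + vdim (families\<lparr>carrier := motions S\<rparr>)"
proof -
  let ?d = "coboundary G \<sigma> \<M>"
  interpret d: linear_map class_ring C0 C1 ?d by (rule coboundary_linear)
  have "?d ` class0 ` carrier families = (\<lambda>x. class1 (lift x)) ` carrier families"
    using coboundary_class0 by (force simp: image_image)
  then have im: "?d ` carrier C0 = (\<lambda>x. class1 (lift x)) ` carrier families"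
    by (simp add: class0_surj)
  have ker: "{x \<in> carrier families. class1 (lift x) = \<zero>\<^bsub>C1\<^esub>} = motions S"
    using class1_lift_zero by (auto simp: motions_def)
  have 1: "vdim (C1\<lparr>carrier := ?d ` carrier C0\<rparr>) + vdim (families\<lparr>carrier := motions S\<rparr>) = vdim families"
    using real_rank_nullity[OF class1_lift_linear families_fin_dim] by (simp add: im ker)
  have "h0 V E \<sigma> \<V> S = vdim (C0\<lparr>carrier := {x \<in> carrier C0. ?d x = \<zero>\<^bsub>C1\<^esub>}\<rparr>)"
    by (simp add: h0_def H0_def d.ker_def)
  then have 2: "vdim (C1\<lparr>carrier := ?d ` carrier C0\<rparr>) + h0 V E \<sigma> \<V> S = vdim C0"
    using real_rank_nullity[OF coboundary_linear cochains_dim(1)] by simp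
  have "h1 V E \<sigma> \<V> S = vdim (quotient_space C1 (?d ` carrier C0))"
    by (simp add: h1_def H1_def d.im_def)
  then have 3: "h1 V E \<sigma> \<V> S + vdim (C1\<lparr>carrier := ?d ` carrier C0\<rparr>) = vdim C1"
    using quotient_space_dim(2)[OF cochains_vectorspace(2) cochains_dim(2) linear_map_image_kernel(1)[OF coboundary_linear]]
    by simp
  from 1 2 3 show "h0 V E \<sigma> \<V> S + vdim families = vdim C0 + vdim (families\<lparr>carrier := motions S\<rparr>)"
    "h1 V E \<sigma> \<V> S + vdim families = vdim C1 + vdim (families\<lparr>carrier := motions S\<rparr>)"
    by simp_all
qed

lemma motions_subspace: "VectorSpace.subspace class_ring (motions S) families"
proof -
  have "motions S = {x \<in> carrier families. class1 (lift x) = \<zero>\<^bsub>C1\<^esub>}"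
    using class1_lift_zero by (auto simp: motions_def)
  then show ?thesis using linear_map_image_kernel(2)[OF class1_lift_linear] by simp
qed

end

end

section \<open>Semicontinuity of kernel dimensions\<close>

text \<open>For finite \<open>J\<close> and L the matrix of values \<open>l j (x a)\<close>, this is
  the transpose of L times L. By Cauchy-Binet its determinant is the sum of the squares of the
  maximal minors of L, that is, of those of size \<open>r\<close>.\<close>

definition gram :: "nat \<Rightarrow> 'j set \<Rightarrow> ('j \<Rightarrow> 'a \<Rightarrow> real) \<Rightarrow> (nat \<Rightarrow> 'a) \<Rightarrow> real mat" where
  "gram r J l x = mat r r (\<lambda>(a, b). \<Sum>j\<in>J. l j (x a) * l j (x b))"

text \<open>The situation at a single point of the parameter space: \<open>X\<close> and
  \<open>J\<close> stay fixed, while \<open>l\<close> and the common kernel \<open>K\<close> depend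
  on the point.\<close>

locale functionals =
  fixes X :: "(real, 'a) module" and J :: "'j set" and l :: "'j \<Rightarrow> 'a \<Rightarrow> real" and K :: "'a set"
  assumes X: "real_vectorspace X" and fin: "vectorspace.fin_dim class_ring X" and J: "finite J"
    and l_add: "j \<in> J \<Longrightarrow> x \<in> carrier X \<Longrightarrow> y \<in> carrier X \<Longrightarrow> l j (x \<oplus>\<^bsub>X\<^esub> y) = l j x + l j y"
    and l_smult: "j \<in> J \<Longrightarrow> x \<in> carrier X \<Longrightarrow> l j (c \<odot>\<^bsub>X\<^esub> x) = c * l j x"
    and K: "K = {x \<in> carrier X. \<forall>j\<in>J. l j x = 0}" and K_sub: "VectorSpace.subspace class_ring K X"
begin

lemma l_comb:
  assumes "j \<in> J" "\<And>a. a < r \<Longrightarrow> x a \<in> carrier X"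
  shows "l j (comb X r x c) = (\<Sum>a<r. c $ a * l j (x a))"
proof -
  have "\<zero>\<^bsub>X\<^esub> \<in> K" using K_sub by (simp add: VectorSpace.subspace_def submodule_def)
  then have "l j \<zero>\<^bsub>X\<^esub> = 0" using assms(1) by (simp add: K)
  moreover have "c $ a \<odot>\<^bsub>X\<^esub> x a \<in> carrier X" if "a \<in> {..<r}" for a
    using that assms(2) by (simp add: real_vectorspace_smult[OF X])
  ultimately show ?thesis
    unfolding comb_def using assms
    by (subst linear_functional_finsum[OF X, where l = "l j"]) (auto simp: l_add l_smult)
qed

text \<open>With z the combination of the \<open>x a\<close>, entry a of the product is the sum over
  j of l_j(x_a) l_j(z). Pairing the product with \<open>c\<close> gives the sum of the l_j(z)^2; if
  the product is zero, every l_j(z) must vanish.\<close>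

lemma gram_kernel:
  assumes x: "\<And>a. a < r \<Longrightarrow> x a \<in> carrier X" and c: "c \<in> carrier_vec r"
  shows "gram r J l x *\<^sub>v c = 0\<^sub>v r \<longleftrightarrow> comb X r x c \<in> K"
proof -
  define z where "z = comb X r x c"
  have z: "z \<in> carrier X"
    using linear_mapD(3)[OF comb_linear[OF X x]] c by (simp add: z_def module_vec_simps)
  have lz: "l j z = (\<Sum>b<r. c $ b * l j (x b))" if "j \<in> J" for j
    unfolding z_def by (rule l_comb[OF that x])
  have entry: "(gram r J l x *\<^sub>v c) $ a = (\<Sum>j\<in>J. l j (x a) * l j z)" if "a < r" for a
  proof -
    have "(gram r J l x *\<^sub>v c) $ a = (\<Sum>b<r. (\<Sum>j\<in>J. l j (x a) * l j (x b)) * c $ b)"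
      using that c by (auto simp: gram_def scalar_prod_def atLeast0LessThan intro!: sum.cong)
    also have "\<dots> = (\<Sum>b<r. \<Sum>j\<in>J. l j (x a) * l j (x b) * c $ b)"
      by (simp add: sum_distrib_right)
    also have "\<dots> = (\<Sum>j\<in>J. \<Sum>b<r. l j (x a) * l j (x b) * c $ b)"
      by (rule sum.swap)
    also have "\<dots> = (\<Sum>j\<in>J. l j (x a) * l j z)"
      by (rule sum.cong) (auto simp: lz sum_distrib_left ac_simps)
    finally show ?thesis .
  qed
  show ?thesis
  proof
    assume "comb X r x c \<in> K"
    then have "l j z = 0" if "j \<in> J" for j using that by (simp add: K z_def)
    then show "gram r J l x *\<^sub>v c = 0\<^sub>v r"
      by (intro eq_vecI) (auto simp: entry simp del: index_mult_mat_vec, simp add: gram_def)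
  next
    assume 0: "gram r J l x *\<^sub>v c = 0\<^sub>v r"
    have "(\<Sum>j\<in>J. l j z * l j z) = (\<Sum>j\<in>J. \<Sum>b<r. c $ b * (l j (x b) * l j z))"
    proof (rule sum.cong[OF refl])
      fix j assume "j \<in> J"
      then show "l j z * l j z = (\<Sum>b<r. c $ b * (l j (x b) * l j z))"
        by (subst (1) lz) (simp_all add: sum_distrib_right mult.assoc)
    qed
    also have "\<dots> = (\<Sum>b<r. c $ b * (gram r J l x *\<^sub>v c) $ b)"
      by (subst sum.swap) (auto simp: entry sum_distrib_left simp del: index_mult_mat_vec)
    also have "\<dots> = 0" unfolding 0 by simp
    finally have "\<forall>j\<in>J. l j z * l j z = 0"
      using J by (subst (asm) sum_nonneg_eq_0_iff) auto
    then show "comb X r x c \<in> K" using z by (auto simp: K z_def)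
  qed
qed

text \<open>The right-hand side expresses that the classes of the \<open>x a\<close> in X/K are
  linearly independent; a square matrix is nonsingular iff its kernel is trivial.\<close>

lemma gram_det:
  assumes "\<And>a. a < r \<Longrightarrow> x a \<in> carrier X"
  shows "det (gram r J l x) \<noteq> 0 \<longleftrightarrow> (\<forall>c\<in>carrier_vec r. comb X r x c \<in> K \<longrightarrow> c = 0\<^sub>v r)"
  using det_0_iff_vec_prod_zero_field[of "gram r J l x" r] gram_kernel[of r x] assms
  by (auto simp: gram_def)

text \<open>A nonzero determinant makes the map from R^r to X/K, sending \<open>c\<close> to the
  class of its combination, injective.\<close>

lemma gram_det_bound:
  assumes x: "\<And>a. a < r \<Longrightarrow> x a \<in> carrier X" and det: "det (gram r J l x) \<noteq> 0"
  shows "r + vdim (X\<lparr>carrier := K\<rparr>) \<le> vdim X"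
proof -
  note comb = comb_linear[OF X x]
  have lin: "linear_map class_ring (module_vec TYPE(real) r) (quotient_space X K)
      (\<lambda>c. K +>\<^bsub>X\<^esub> comb X r x c)"
    by (rule linear_map_comp[OF comb quotient_projection_linear[OF X K_sub]])
  have "inj_on (\<lambda>c. K +>\<^bsub>X\<^esub> comb X r x c) (carrier (module_vec TYPE(real) r))"
  proof (rule linear_map_injI[OF lin])
    fix c assume c: "c \<in> carrier (module_vec TYPE(real) r)"
      and "K +>\<^bsub>X\<^esub> comb X r x c = \<zero>\<^bsub>quotient_space X K\<^esub>"
    then have "comb X r x c \<in> K"
      using quotient_projection_zero[OF X K_sub linear_mapD(3)[OF comb c]] by simp
    then show "c = \<zero>\<^bsub>module_vec TYPE(real) r\<^esub>"
      using gram_det[of r x] x det c by (simp add: module_vec_simps)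
  qed
  then have "r \<le> vdim (quotient_space X K)"
    using linear_map_inj_dim_le[OF lin module_vec_real(2) quotient_space_dim(1)[OF X fin K_sub]]
    by (simp add: module_vec_real)
  then show ?thesis using quotient_space_dim(2)[OF X fin K_sub] by simp
qed

text \<open>Here \<open>r\<close> is the dimension of X/K, and representatives of a basis of X/K
  form a suitable tuple.\<close>

lemma gram_det_exists:
  assumes r: "r + vdim (X\<lparr>carrier := K\<rparr>) = vdim X"
  obtains x where "\<And>a. a < r \<Longrightarrow> x a \<in> carrier X" "det (gram r J l x) \<noteq> 0"
proof -
  let ?Q = "quotient_space X K"
  have "vdim ?Q = r" using quotient_space_dim(2)[OF X fin K_sub] r by simp
  with basis_tuple_exists[OF quotient_space_vectorspace[OF X K_sub] quotient_space_dim(1)[OF X fin K_sub]]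
  obtain y where y: "\<And>a. a < r \<Longrightarrow> y a \<in> carrier ?Q"
    and bij: "bij_betw (comb ?Q r y) (carrier_vec r) (carrier ?Q)" by metis
  have "\<forall>a\<in>{..<r}. \<exists>u. u \<in> carrier X \<and> K +>\<^bsub>X\<^esub> u = y a"
    using y unfolding quotient_projection_surj[OF X K_sub, symmetric] by force
  from bchoice[OF this] obtain x where x: "\<And>a. a < r \<Longrightarrow> x a \<in> carrier X"
    and xy: "\<And>a. a < r \<Longrightarrow> K +>\<^bsub>X\<^esub> x a = y a" by auto
  have combQ: "K +>\<^bsub>X\<^esub> comb X r x c = comb ?Q r y c" for c
  proof -
    interpret Q: vectorspace class_ring ?Q by (rule quotient_space_vectorspace[OF X K_sub])
    have "comb ?Q r (\<lambda>a. K +>\<^bsub>X\<^esub> x a) c = comb ?Q r y c"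
      unfolding comb_def
      by (rule Q.M.finsum_cong') (use y xy in \<open>auto simp: real_vectorspace_smult[OF Q.vectorspace_axioms]\<close>)
    then show ?thesis
      using linear_map_comb[OF quotient_projection_linear[OF X K_sub] x] by simp
  qed
  have "c = 0\<^sub>v r" if c: "c \<in> carrier_vec r" "comb X r x c \<in> K" for c
  proof -
    have "comb X r x c \<in> carrier X" using c(2) by (simp add: K)
    then have "comb ?Q r y c = \<zero>\<^bsub>?Q\<^esub>"
      using c(2) quotient_projection_zero[OF X K_sub] combQ by metis
    also have "\<dots> = comb ?Q r y (0\<^sub>v r)"
      using linear_mapD(6)[OF comb_linear[OF quotient_space_vectorspace[OF X K_sub] y]]
      by (simp add: module_vec_simps)
    finally show ?thesis using bij c(1) by (auto simp: bij_betw_def dest: inj_onD)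
  qed
  then show ?thesis using that[of x] gram_det[of r x] x by simp
qed

end

section \<open>Polynomial functions of the projection entries and their nonvanishing loci\<close>

lemma grassmannian_poly_sum:
  "(\<And>a. a \<in> A \<Longrightarrow> grassmannian_poly n s \<phi> V (\<lambda>S. p a S)) \<Longrightarrow>
    grassmannian_poly n s \<phi> V (\<lambda>S. \<Sum>a\<in>A. p a S)"
  by (induction A rule: infinite_finite_induct) (auto intro: grassmannian_poly.intros)

lemma grassmannian_poly_prod:
  "(\<And>a. a \<in> A \<Longrightarrow> grassmannian_poly n s \<phi> V (\<lambda>S. p a S)) \<Longrightarrow>
    grassmannian_poly n s \<phi> V (\<lambda>S. \<Prod>a\<in>A. p a S)"
  by (induction A rule: infinite_finite_induct) (auto intro: grassmannian_poly.intros)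

text \<open>The Leibniz formula writes the determinant as a sum of products of entries. Permutations
  keep the indices below \<open>r\<close>, where the hypothesis on the entries applies.\<close>

lemma grassmannian_poly_det:
  assumes "\<And>S. M S \<in> carrier_mat r r"
    and "\<And>a b. a < r \<Longrightarrow> b < r \<Longrightarrow> grassmannian_poly n s \<phi> V (\<lambda>S. M S $$ (a, b))"
  shows "grassmannian_poly n s \<phi> V (\<lambda>S. det (M S))"
proof -
  have "p a < r" if "p permutes {0..<r}" "a < r" for p a
    using that permutes_in_image[OF that(1), of a] by simp
  then show ?thesis
    unfolding det_def'[OF assms(1)]
    by (intro grassmannian_poly_sum grassmannian_poly.mult grassmannian_poly_prod grassmannian_poly.const)
      (auto intro!: assms(2))
qed

lemma openin_zariski_subtopology:
  assumes "U \<subseteq> grassmannian_power V s \<V>" "\<And>p. p \<in> F \<Longrightarrow> grassmannian_poly n s \<phi> V p"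
  shows "openin (subtopology (zariski_topology n s \<V> \<phi> V) U) {S \<in> U. \<exists>p\<in>F. p S \<noteq> 0}"
  unfolding openin_subtopology openin_zariski_topology
  using assms
  by (intro exI[of _ "grassmannian_power V s \<V> - {S \<in> grassmannian_power V s \<V>. \<forall>p\<in>F. p S = 0}"] conjI exI[of _ F]) auto

lemma kernel_dim_upper_semicontinuous:
  assumes U: "U \<subseteq> grassmannian_power V s \<V>"
    and l: "\<And>S. S \<in> U \<Longrightarrow> functionals X J (l S) (K S)"
    and poly: "\<And>j x. j \<in> J \<Longrightarrow> x \<in> carrier X \<Longrightarrow> grassmannian_poly n s \<phi> V (\<lambda>S. l S j x)"
  shows "openin (subtopology (zariski_topology n s \<V> \<phi> V) U)
    {S \<in> U. int (vdim (X\<lparr>carrier := K S\<rparr>)) < b}"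
proof -
  define F where "F = {\<lambda>S. det (gram r J (l S) x) | r x.
    int (vdim X) < int r + b \<and> (\<forall>a<r. x a \<in> carrier X)}"
  have "(\<exists>p\<in>F. p S \<noteq> 0) \<longleftrightarrow> int (vdim (X\<lparr>carrier := K S\<rparr>)) < b" if S: "S \<in> U" for S
  proof -
    interpret functionals X J "l S" "K S" by (rule l[OF S])
    show ?thesis
    proof
      assume "\<exists>p\<in>F. p S \<noteq> 0"
      then obtain r x where "int (vdim X) < int r + b" "\<And>a. a < r \<Longrightarrow> x a \<in> carrier X"
          "det (gram r J (l S) x) \<noteq> 0"
        unfolding F_def by blast
      with gram_det_bound[of r x] show "int (vdim (X\<lparr>carrier := K S\<rparr>)) < b" by simp
    next
      assume b: "int (vdim (X\<lparr>carrier := K S\<rparr>)) < b"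
      define r where "r = vdim X - vdim (X\<lparr>carrier := K S\<rparr>)"
      have r: "r + vdim (X\<lparr>carrier := K S\<rparr>) = vdim X"
        using quotient_space_dim(2)[OF X fin K_sub] by (simp add: r_def)
      from gram_det_exists[OF this] obtain x where
        x: "\<And>a. a < r \<Longrightarrow> x a \<in> carrier X" "det (gram r J (l S) x) \<noteq> 0" by blast
      \<comment> \<open>The tuple \<open>x\<close> was found at one particular point; it is now
        frozen, and the bound \<open>S\<close> runs over all points.\<close>
      have F: "(\<lambda>S. det (gram r J (l S) x)) \<in> F"
        unfolding F_def using x(1) r b by fastforce
      show "\<exists>p\<in>F. p S \<noteq> 0" by (rule bexI[OF _ F]) (rule x(2))
    qed
  qed
  then have eq: "{S \<in> U. int (vdim (X\<lparr>carrier := K S\<rparr>)) < b} = {S \<in> U. \<exists>p\<in>F. p S \<noteq> 0}" by blast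
  show ?thesis unfolding eq
  proof (rule openin_zariski_subtopology[OF U])
    fix p assume "p \<in> F"
    then obtain r x where p: "p = (\<lambda>S. det (gram r J (l S) x))" "\<And>a. a < r \<Longrightarrow> x a \<in> carrier X"
      unfolding F_def by blast
    show "grassmannian_poly n s \<phi> V p"
      unfolding p(1)
      by (rule grassmannian_poly_det[of _ r])
        (auto simp: gram_def intro!: grassmannian_poly_sum grassmannian_poly.mult poly p(2))
  qed
qed

section \<open>Orthogonal projections\<close>

text \<open>Cyclicity of the trace for rectangular factors. It gives trace \<open>s\<close> to a
  projection A L with L A the identity of size \<open>s\<close>.\<close>

lemma sum_diag_mult_commute:
  fixes A B :: "real mat"
  assumes "A \<in> carrier_mat n m" "B \<in> carrier_mat m n"
  shows "(\<Sum>i<n. (A * B) $$ (i, i)) = (\<Sum>k<m. (B * A) $$ (k, k))"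
proof -
  have "(\<Sum>i<n. (A * B) $$ (i, i)) = (\<Sum>i<n. \<Sum>k<m. A $$ (i, k) * B $$ (k, i))"
    using assms by (auto simp: scalar_prod_def atLeast0LessThan intro!: sum.cong)
  also have "\<dots> = (\<Sum>k<m. \<Sum>i<n. B $$ (k, i) * A $$ (i, k))"
    by (subst sum.swap) (simp add: mult.commute)
  also have "\<dots> = (\<Sum>k<m. (B * A) $$ (k, k))"
    using assms by (auto simp: scalar_prod_def atLeast0LessThan intro!: sum.cong)
  finally show ?thesis .
qed

text \<open>The orthogonal projection onto the column space is A (A^t A)^-1 A^t. The Gram matrix A^t
  A is invertible because A^t A c = 0 implies |A c|^2 = 0, hence c = 0. In the proof
  \<open>M\<close> is its inverse and \<open>L\<close> a left inverse of \<open>A\<close>, which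
  accounts for idempotence and the trace.\<close>

lemma full_rank_projection:
  fixes A :: "real mat"
  assumes A: "A \<in> carrier_mat n s"
    and inj: "\<And>c. c \<in> carrier_vec s \<Longrightarrow> A *\<^sub>v c = 0\<^sub>v n \<Longrightarrow> c = 0\<^sub>v s"
  shows "\<exists>P\<in>projection_variety n s. (\<lambda>x. P *\<^sub>v x) ` carrier_vec n = (\<lambda>c. A *\<^sub>v c) ` carrier_vec s"
proof -
  define At where "At = transpose_mat A"
  define B where "B = At * A"
  have At: "At \<in> carrier_mat s n" and B: "B \<in> carrier_mat s s" using A by (simp_all add: At_def B_def)
  have "c = 0\<^sub>v s" if c: "c \<in> carrier_vec s" and 0: "B *\<^sub>v c = 0\<^sub>v s" for c
  proof (rule inj[OF c])
    have Ac: "A *\<^sub>v c \<in> carrier_vec n" using A c by simp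
    have "(A *\<^sub>v c) \<bullet> (A *\<^sub>v c) = (At *\<^sub>v (A *\<^sub>v c)) \<bullet> c"
      unfolding At_def by (rule transpose_vec_mult_scalar[OF A c Ac, symmetric])
    also have "At *\<^sub>v (A *\<^sub>v c) = B *\<^sub>v c"
      unfolding B_def by (rule assoc_mult_mat_vec[OF At A c, symmetric])
    finally have "(A *\<^sub>v c) \<bullet> (A *\<^sub>v c) = 0" using c by (simp add: 0)
    then have "(\<Sum>i<n. (A *\<^sub>v c) $ i * (A *\<^sub>v c) $ i) = 0"
      using A by (simp add: scalar_prod_def atLeast0LessThan)
    then have "\<forall>i<n. (A *\<^sub>v c) $ i = 0"
      by (subst (asm) sum_nonneg_eq_0_iff) auto
    then show "A *\<^sub>v c = 0\<^sub>v n" using A by (intro eq_vecI) auto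
  qed
  then have "det B \<noteq> 0" using det_0_iff_vec_prod_zero_field[OF B] by blast
  from det_non_zero_imp_unit[OF B this, of "()"] obtain M where
    M: "M \<in> carrier_mat s s" and MB: "M * B = 1\<^sub>m s" and BM: "B * M = 1\<^sub>m s"
    by (auto simp: Units_def ring_mat_def)
  have Mt: "transpose_mat M \<in> carrier_mat s s" using M by simp
  have Bt: "transpose_mat B = B"
    using transpose_mult[OF At A] by (simp add: B_def At_def)
  have "transpose_mat M = transpose_mat M * (B * M)" using BM Mt by simp
  also have "\<dots> = (transpose_mat M * B) * M" using assoc_mult_mat[OF Mt B M] by simp
  also have "transpose_mat M * B = transpose_mat (B * M)"
    using transpose_mult[OF B M] Bt by simp
  finally have Msym: "transpose_mat M = M" using M by (simp add: BM)
  define L where "L = M * At"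
  define P where "P = A * L"
  have L: "L \<in> carrier_mat s n" and P: "P \<in> carrier_mat n n" using A M At by (simp_all add: L_def P_def)
  have LA: "L * A = 1\<^sub>m s"
    using assoc_mult_mat[OF M At A] MB by (simp add: L_def B_def)
  have PA: "P * A = A" using assoc_mult_mat[OF A L A] LA A by (simp add: P_def)
  have "P * P = (P * A) * L" using assoc_mult_mat[OF P A L] by (simp add: P_def)
  then have PP: "P * P = P" by (simp add: PA) (simp add: P_def)
  have "transpose_mat P = transpose_mat L * At" using transpose_mult[OF A L] by (simp add: P_def At_def)
  also have "transpose_mat L = A * M" using transpose_mult[OF M At] Msym by (simp add: L_def At_def)
  also have "A * M * At = P" using assoc_mult_mat[OF A M At] by (simp add: P_def L_def)
  finally have Pt: "transpose_mat P = P" .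
  have "(\<Sum>i<n. P $$ (i, i)) = (\<Sum>k<s. (L * A) $$ (k, k))"
    unfolding P_def by (rule sum_diag_mult_commute[OF A L])
  then have "P \<in> projection_variety n s"
    using P PP Pt by (simp add: projection_variety_def LA)
  moreover have "(\<lambda>x. P *\<^sub>v x) ` carrier_vec n = (\<lambda>c. A *\<^sub>v c) ` carrier_vec s"
  proof (intro equalityI subsetI)
    fix y assume "y \<in> (\<lambda>x. P *\<^sub>v x) ` carrier_vec n"
    then obtain x where x: "x \<in> carrier_vec n" "y = P *\<^sub>v x" by blast
    then have "y = A *\<^sub>v (L *\<^sub>v x)" using assoc_mult_mat_vec[OF A L x(1)] by (simp add: P_def)
    moreover have "L *\<^sub>v x \<in> carrier_vec s" using L x by simp
    ultimately show "y \<in> (\<lambda>c. A *\<^sub>v c) ` carrier_vec s" by blast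
  next
    fix y assume "y \<in> (\<lambda>c. A *\<^sub>v c) ` carrier_vec s"
    then obtain c where c: "c \<in> carrier_vec s" "y = A *\<^sub>v c" by blast
    then have "y = P *\<^sub>v (A *\<^sub>v c)" using assoc_mult_mat_vec[OF P A c(1)] by (simp add: PA)
    moreover have "A *\<^sub>v c \<in> carrier_vec n" using A c by simp
    ultimately show "y \<in> (\<lambda>x. P *\<^sub>v x) ` carrier_vec n" by blast
  qed
  ultimately show ?thesis by blast
qed

lemma projection_fixed:
  assumes P: "P \<in> projection_variety n s" and v: "v \<in> carrier_vec n"
  shows "P *\<^sub>v v = v \<longleftrightarrow> v \<in> (\<lambda>x. P *\<^sub>v x) ` carrier_vec n"
proof
  assume "v \<in> (\<lambda>x. P *\<^sub>v x) ` carrier_vec n"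
  then obtain x where x: "x \<in> carrier_vec n" "v = P *\<^sub>v x" by blast
  have "P *\<^sub>v (P *\<^sub>v x) = (P * P) *\<^sub>v x"
    using P x by (intro assoc_mult_mat_vec[symmetric]) (auto simp: projection_variety_def)
  then show "P *\<^sub>v v = v" using P x by (simp add: projection_variety_def)
qed (use v in \<open>metis imageI\<close>)

text \<open>Each projection fixes the columns of the other, as they lie in the common image, so Q P
  = P and P Q = Q. Transposing the former equation turns it into P = P Q, hence P = Q.\<close>

lemma projection_unique:
  assumes P: "P \<in> projection_variety n s" and Q: "Q \<in> projection_variety n s"
    and im: "(\<lambda>x. P *\<^sub>v x) ` carrier_vec n = (\<lambda>x. Q *\<^sub>v x) ` carrier_vec n"
  shows "P = Q"
proof -
  have fix_mult: "B * A = A"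
    if A: "A \<in> projection_variety n s" and B: "B \<in> projection_variety n s"
      and im: "(\<lambda>x. A *\<^sub>v x) ` carrier_vec n = (\<lambda>x. B *\<^sub>v x) ` carrier_vec n" for A B
  proof (rule mat_col_eqI)
    have c: "A \<in> carrier_mat n n" "B \<in> carrier_mat n n"
      using A B by (simp_all add: projection_variety_def)
    fix j assume "j < dim_col A"
    then have j: "j < n" using c by simp
    then have "col A j = A *\<^sub>v unit_vec n j" using c by (intro eq_vecI) auto
    then have "col A j \<in> (\<lambda>x. B *\<^sub>v x) ` carrier_vec n" unfolding im[symmetric] by auto
    moreover have "col (B * A) j = B *\<^sub>v col A j" using j c by (intro eq_vecI) auto
    ultimately show "col (B * A) j = col A j"
      using projection_fixed[OF B, of "col A j"] j c by auto
  qed (use that in \<open>auto simp: projection_variety_def\<close>)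
  have c: "P \<in> carrier_mat n n" "Q \<in> carrier_mat n n" "transpose_mat P = P" "transpose_mat Q = Q"
    using P Q by (simp_all add: projection_variety_def)
  have "P = transpose_mat (Q * P)" using fix_mult[OF P Q im] c by simp
  also have "\<dots> = P * Q" using transpose_mult[OF c(2,1)] c by simp
  also have "\<dots> = Q" by (rule fix_mult[OF Q P im[symmetric]])
  finally show ?thesis .
qed

text \<open>The projection is defined by \<open>THE\<close>, so existence and uniqueness are both
  required. For existence, the columns of \<open>A\<close> are the coordinate vectors of a basis of
  \<open>W\<close>; injectivity of \<phi> gives \<open>A\<close> full column rank.\<close>

lemma projection_of:
  assumes vs: "real_vectorspace \<V>" and fd: "vectorspace.fin_dim class_ring \<V>"
    and \<phi>: "linear_coordinates n \<V> \<phi>" and W: "W \<in> grassmannian s \<V>"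
  shows "projection_of n s \<phi> W \<in> projection_variety n s"
    and "(\<lambda>x. projection_of n s \<phi> W *\<^sub>v x) ` carrier_vec n = \<phi> ` W"
proof -
  let ?W = "\<V>\<lparr>carrier := W\<rparr>" and ?R = "module_vec TYPE(real) n"
  have sub: "VectorSpace.subspace class_ring W \<V>" and dim: "vdim ?W = s"
    using W by (auto simp: grassmannian_def)
  have vW: "real_vectorspace ?W" by (rule vectorspace.subspace_is_vs[OF vs sub])
  have WV: "W \<subseteq> carrier \<V>" using sub by (simp add: VectorSpace.subspace_def submodule_def)
  have \<phi>l: "linear_map class_ring \<V> ?R \<phi>" and bij: "bij_betw \<phi> (carrier \<V>) (carrier_vec n)"
    using \<phi> by (auto simp: linear_coordinates_def)
  note pl = linear_mapD[OF \<phi>l, unfolded module_vec_simps]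
  have lW: "linear_map class_ring ?W ?R \<phi>"
    by (rule linear_mapI[OF vW module_vec_real(1)])
      (simp_all add: module_vec_simps pl(3-5) subsetD[OF WV])
  obtain x where x: "\<And>a. a < s \<Longrightarrow> x a \<in> W"
    and xb: "bij_betw (comb ?W s x) (carrier_vec s) W"
    using basis_tuple_exists[OF vW subspace_fin_dim[OF vs fd sub]] unfolding dim by auto
  define A where "A = mat n s (\<lambda>(i, a). \<phi> (x a) $ i)"
  have A: "A \<in> carrier_mat n s" by (simp add: A_def)
  have \<phi>x: "\<phi> (x a) \<in> carrier_vec n" if "a < s" for a using pl(3) x[OF that] WV by blast
  have Ac: "A *\<^sub>v c = \<phi> (comb ?W s x c)" if c: "c \<in> carrier_vec s" for c
  proof -
    have eq: "\<phi> (comb ?W s x c) = comb ?R s (\<lambda>a. \<phi> (x a)) c"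
      by (rule linear_map_comb[OF lW]) (simp add: x)
    have car: "comb ?R s (\<lambda>a. \<phi> (x a)) c \<in> carrier_vec n"
      using linear_mapD(3)[OF comb_linear[OF module_vec_real(1), of s "\<lambda>a. \<phi> (x a)"]] \<phi>x c
      by (simp add: module_vec_simps)
    have "comb ?R s (\<lambda>a. \<phi> (x a)) c $ i = (\<Sum>a<s. c $ a * \<phi> (x a) $ i)" if "i < n" for i
    proof -
      have "comb ?R s (\<lambda>a. \<phi> (x a)) c $ i = (\<Sum>a<s. (c $ a \<odot>\<^bsub>?R\<^esub> \<phi> (x a)) $ i)"
        unfolding comb_def using \<phi>x that
        by (intro linear_functional_finsum[OF module_vec_real(1)]) (auto simp: module_vec_simps)
      also have "\<dots> = (\<Sum>a<s. c $ a * \<phi> (x a) $ i)"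
        using that by (intro sum.cong) (auto simp: module_vec_simps carrier_vecD[OF \<phi>x])
      finally show ?thesis .
    qed
    then show ?thesis unfolding eq using car A c
      by (intro eq_vecI) (auto simp: A_def scalar_prod_def atLeast0LessThan ac_simps)
  qed
  have "c = 0\<^sub>v s" if c: "c \<in> carrier_vec s" and 0: "A *\<^sub>v c = 0\<^sub>v n" for c
  proof -
    have W0: "\<zero>\<^bsub>\<V>\<^esub> \<in> W" using sub by (simp add: VectorSpace.subspace_def submodule_def)
    have "comb ?W s x c \<in> W" using xb c by (auto simp: bij_betw_def)
    moreover have "\<phi> (comb ?W s x c) = \<phi> \<zero>\<^bsub>\<V>\<^esub>" using Ac[OF c] 0 pl(6) by simp
    ultimately have "comb ?W s x c = \<zero>\<^bsub>\<V>\<^esub>"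
      using bij_betw_imp_inj_on[OF bij] WV W0 by (auto dest: inj_onD)
    moreover have "comb ?W s x (0\<^sub>v s) = \<zero>\<^bsub>\<V>\<^esub>"
      using linear_mapD(6)[OF comb_linear[OF vW, of s x]] x by (simp add: module_vec_simps)
    ultimately show ?thesis
      by (intro inj_onD[OF bij_betw_imp_inj_on[OF xb] _ c]) simp_all
  qed
  from full_rank_projection[OF A this] obtain P where P: "P \<in> projection_variety n s"
    "(\<lambda>x. P *\<^sub>v x) ` carrier_vec n = (\<lambda>c. A *\<^sub>v c) ` carrier_vec s" by blast
  have "(\<lambda>c. A *\<^sub>v c) ` carrier_vec s = \<phi> ` comb ?W s x ` carrier_vec s"
    unfolding image_image by (intro image_cong refl Ac)
  also have "\<dots> = \<phi> ` W" using xb by (simp add: bij_betw_def)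
  finally have im: "(\<lambda>x. P *\<^sub>v x) ` carrier_vec n = \<phi> ` W" using P(2) by simp
  have "\<exists>!P. P \<in> projection_variety n s \<and> (\<lambda>x. P *\<^sub>v x) ` carrier_vec n = \<phi> ` W"
    using P(1) im projection_unique by (intro ex1I[of _ P]) auto
  from theI'[OF this] show "projection_of n s \<phi> W \<in> projection_variety n s"
    "(\<lambda>x. projection_of n s \<phi> W *\<^sub>v x) ` carrier_vec n = \<phi> ` W"
    unfolding projection_of_def by blast+
qed

text \<open>The right-hand side says that the coordinate vector of \<open>u\<close> is fixed by the
  projection. Membership in a varying subspace thus becomes the vanishing of \<open>n\<close>
  functions that are affine in the entries of the projection matrix and linear in
  \<open>u\<close>.\<close>

lemma mem_subspace_iff_projection:
  assumes "real_vectorspace \<V>" "vectorspace.fin_dim class_ring \<V>"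
    and \<phi>: "linear_coordinates n \<V> \<phi>" and W: "W \<in> grassmannian s \<V>" and u: "u \<in> carrier \<V>"
  shows "u \<in> W \<longleftrightarrow>
    (\<forall>k<n. \<phi> u $ k - (\<Sum>m<n. projection_of n s \<phi> W $$ (k, m) * \<phi> u $ m) = 0)"
proof -
  let ?P = "projection_of n s \<phi> W"
  note P = projection_of[OF assms(1-4)]
  have bij: "bij_betw \<phi> (carrier \<V>) (carrier_vec n)" using \<phi> by (simp add: linear_coordinates_def)
  then have \<phi>u: "\<phi> u \<in> carrier_vec n" using u by (auto simp: bij_betw_def)
  have Pc: "?P \<in> carrier_mat n n" using P(1) by (simp add: projection_variety_def)
  have "W \<subseteq> carrier \<V>" using W by (simp add: grassmannian_def VectorSpace.subspace_def submodule_def)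
  then have "u \<in> W \<longleftrightarrow> \<phi> u \<in> \<phi> ` W"
    using bij_betw_imp_inj_on[OF bij] u by (auto dest: inj_onD)
  also have "\<dots> \<longleftrightarrow> ?P *\<^sub>v \<phi> u = \<phi> u" using projection_fixed[OF P(1) \<phi>u] P(2) by simp
  also have "\<dots> \<longleftrightarrow> (\<forall>k<n. (?P *\<^sub>v \<phi> u) $ k = \<phi> u $ k)"
    using Pc \<phi>u by (auto intro!: eq_vecI simp del: index_mult_mat_vec)
  also have "\<dots> \<longleftrightarrow> (\<forall>k<n. \<phi> u $ k - (\<Sum>m<n. ?P $$ (k, m) * \<phi> u $ m) = 0)"
  proof (intro all_cong)
    fix k assume "k < n"
    then have "(?P *\<^sub>v \<phi> u) $ k = (\<Sum>m<n. ?P $$ (k, m) * \<phi> u $ m)"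
      using Pc \<phi>u by (auto simp: scalar_prod_def atLeast0LessThan intro!: sum.cong)
    then show "(?P *\<^sub>v \<phi> u) $ k = \<phi> u $ k \<longleftrightarrow> \<phi> u $ k - (\<Sum>m<n. ?P $$ (k, m) * \<phi> u $ m) = 0"
      by linarith
  qed
  finally show ?thesis .
qed

section \<open>Semicontinuity of the cohomology of motion sheaves\<close>

theorem mainTheorem10:
  fixes V :: "'v set" and E :: "'v set set"
    and \<V> :: "(real, 'b) module" and n s :: nat
    and \<phi> :: "'b \<Rightarrow> real vec"
    and \<sigma> :: "'v + 'v set \<Rightarrow> 'v \<times> 'v set \<Rightarrow> real"
    and U :: "('v \<Rightarrow> 'b set) set"
  assumes "finite V" and "E \<subseteq> Pow V"
    and "real_vectorspace \<V>" and "vectorspace.fin_dim class_ring \<V>" and "vdim \<V> = n"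
    and "linear_coordinates n \<V> \<phi>"
    and "incidence_signs (incidence_graph V E) \<sigma>"
    and "U \<subseteq> grassmannian_power V s \<V>"
    and "semialgebraic n s \<V> \<phi> V U"
    and "\<And>e. e \<in> E \<Longrightarrow>
           \<exists>c. \<forall>S\<in>U. vdim (\<V>\<lparr>carrier := common_subspace \<V> S e\<rparr>) = c"
  shows "upper_semicontinuous (subtopology (zariski_topology n s \<V> \<phi> V) U)
             (\<lambda>S. int (h0 V E \<sigma> \<V> S)) \<and>
         upper_semicontinuous (subtopology (zariski_topology n s \<V> \<phi> V) U)
             (\<lambda>S. int (h1 V E \<sigma> \<V> S)) \<and>
         (U \<noteq> {} \<longrightarrow>
           (\<exists>W. openin (subtopology (zariski_topology n s \<V> \<phi> V) U) W \<and> W \<noteq> {} \<and>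
             (\<forall>S\<in>W. \<forall>T\<in>U. h0 V E \<sigma> \<V> S \<le> h0 V E \<sigma> \<V> T \<and>
                              h1 V E \<sigma> \<V> S \<le> h1 V E \<sigma> \<V> T)))"
proof -
  interpret incidence_data V E \<V> \<sigma>
    by (rule incidence_data.intro[OF assms(1-4)])
  let ?Z = "zariski_topology n s \<V> \<phi> V"
  have top: "topspace (subtopology ?Z U) = U"
    using assms(8) by (auto simp: topspace_zariski_topology)
  have gr: "S v \<in> grassmannian s \<V>" if "S \<in> U" "v \<in> V" for S v
    using assms(8) that by (auto simp: grassmannian_power_def)
  then have sub: "VectorSpace.subspace class_ring (S v) \<V>" and dim: "vdim (\<V>\<lparr>carrier := S v\<rparr>) = s"
    if "S \<in> U" "v \<in> V" for S v
    using that by (auto simp: grassmannian_def)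
  note \<phi>l = linear_mapD[OF conjunct1[OF assms(6)[unfolded linear_coordinates_def]], unfolded module_vec_simps]
  note ll = linear_mapD[OF lift_linear]
  define D where "D S = vdim (families\<lparr>carrier := motions S\<rparr>)" for S
  define J where "J = edges G \<times> {..<n}"
  \<comment> \<open>Coordinate \<open>k\<close> of the component of \<open>lift x i\<close>
    orthogonal to \<open>S (fst i)\<close>.\<close>
  define l where "l S = (\<lambda>(i, k) x. \<phi> (lift x i) $ k -
      (\<Sum>m<n. projection_of n s \<phi> (S (fst i)) $$ (k, m) * \<phi> (lift x i) $ m))" for S :: "'v \<Rightarrow> 'b set"
  have "functionals families J (l S) (motions S)" if S: "S \<in> U" for S
  proof (rule functionals.intro)
    show "finite J" using finite_G by (simp add: J_def)
    show "l S j (x \<oplus>\<^bsub>families\<^esub> y) = l S j x + l S j y"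
      if "j \<in> J" "x \<in> carrier families" "y \<in> carrier families" for j x y
    proof -
      obtain i k where j: "j = (i, k)" "i \<in> edges G" "k < n" using \<open>j \<in> J\<close> unfolding J_def by blast
      have "\<phi> (lift (x \<oplus>\<^bsub>families\<^esub> y) i) $ m = \<phi> (lift x i) $ m + \<phi> (lift y i) $ m" if "m < n" for m
        using that carrier_vecD[OF \<phi>l(3)[OF ll(3)[OF j(2) \<open>y \<in> carrier families\<close>]]]
        by (simp add: ll(3,4) \<phi>l(4) j(2) \<open>x \<in> carrier families\<close> \<open>y \<in> carrier families\<close>)
      then show ?thesis using j(3) by (simp add: l_def j(1) sum.distrib algebra_simps)
    qed
    show "l S j (c \<odot>\<^bsub>families\<^esub> x) = c * l S j x"
      if "j \<in> J" "x \<in> carrier families" for j c x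
    proof -
      obtain i k where j: "j = (i, k)" "i \<in> edges G" "k < n" using \<open>j \<in> J\<close> unfolding J_def by blast
      have "\<phi> (lift (c \<odot>\<^bsub>families\<^esub> x) i) $ m = c * \<phi> (lift x i) $ m" if "m < n" for m
        using that carrier_vecD[OF \<phi>l(3)[OF ll(3)[OF j(2) \<open>x \<in> carrier families\<close>]]]
        by (simp add: ll(3,5) \<phi>l(5) j(2) \<open>x \<in> carrier families\<close>)
      then show ?thesis using j(3) by (simp add: l_def j(1) sum_distrib_left algebra_simps)
    qed
    have "lift x i \<in> S (fst i) \<longleftrightarrow> (\<forall>k<n. l S (i, k) x = 0)"
      if "x \<in> carrier families" "i \<in> edges G" for x i
    proof -
      have "fst i \<in> V" using that by (auto simp: incidence_graph_def)
      from mem_subspace_iff_projection[OF assms(3,4,6) gr[OF S this] ll(3)[OF that(2,1)]]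
      show ?thesis by (simp add: l_def)
    qed
    then show "motions S = {x \<in> carrier families. \<forall>j\<in>J. l S j x = 0}"
      by (auto simp: motions_def J_def)
    show "VectorSpace.subspace class_ring (motions S) families"
      by (rule motions_subspace[OF sub[OF S]])
  qed (rule families_vectorspace families_fin_dim)+
  moreover have "grassmannian_poly n s \<phi> V (\<lambda>S. l S j x)" if j: "j \<in> J" for j x
  proof -
    obtain v e k where jk: "j = ((v, e), k)" "v \<in> V" "k < n"
      using j by (auto simp: J_def incidence_graph_def)
    \<comment> \<open>For fixed \<open>x\<close> the coordinates of \<open>lift x (v, e)\<close> are
      constants in \<open>S\<close>. Polynomial functions are generated by sums and products, so the
      difference is written as adding \<open>-1\<close> times the sum.\<close>
    have "grassmannian_poly n s \<phi> V (\<lambda>S. \<phi> (lift x (v, e)) $ k + (-1) *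
        (\<Sum>m<n. projection_of n s \<phi> (S v) $$ (k, m) * \<phi> (lift x (v, e)) $ m))"
      by (intro grassmannian_poly.add grassmannian_poly.mult grassmannian_poly_sum
          grassmannian_poly.const grassmannian_poly.entry) (use jk in simp_all)
    then show ?thesis by (simp add: l_def jk)
  qed
  ultimately have D_open: "openin (subtopology ?Z U) {S \<in> U. int (D S) < b}" for b
    unfolding D_def by (intro kernel_dim_upper_semicontinuous[OF assms(8), where l = l and J = J])
  obtain c where c: "vdim (\<V>\<lparr>carrier := common_subspace \<V> S e\<rparr>) = c e" if "e \<in> E" "S \<in> U" for e S
    using assms(10) by metis
  \<comment> \<open>A vertex of the hypergraph contributes dim \<V> - s by the definition of the
    Grassmannian, a hyperedge \<open>e\<close> contributes dim \<V> - \<open>c e\<close> by the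
    constancy hypothesis on intersections.\<close>
  define c0 where "c0 = (\<Sum>z\<in>verts G. vdim \<V> - case_sum (\<lambda>_. s) c z)"
  define c1 where "c1 = (\<Sum>i\<in>edges G. vdim \<V> - s)"
  have "vdim (cochains0 G (motion_sheaf \<V> S)) = c0" "vdim (cochains1 G (motion_sheaf \<V> S)) = c1"
    if S: "S \<in> U" for S
  proof -
    have "vdim (cochains0 G (motion_sheaf \<V> S)) =
        (\<Sum>z\<in>verts G. vdim \<V> - vdim (\<V>\<lparr>carrier := vertex_space S z\<rparr>))"
      by (rule cochains_dim(3)) (rule sub[OF S])
    also have "\<dots> = c0"
      unfolding c0_def
      by (rule sum.cong[OF refl])
        (use S c dim in \<open>auto simp: vertex_space_def incidence_graph_def\<close>)
    finally show "vdim (cochains0 G (motion_sheaf \<V> S)) = c0" .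
    have "vdim (cochains1 G (motion_sheaf \<V> S)) =
        (\<Sum>i\<in>edges G. vdim \<V> - vdim (\<V>\<lparr>carrier := S (fst i)\<rparr>))"
      by (rule cochains_dim(4)) (rule sub[OF S])
    also have "\<dots> = c1"
      unfolding c1_def
      by (rule sum.cong[OF refl]) (use S dim in \<open>auto simp: incidence_graph_def\<close>)
    finally show "vdim (cochains1 G (motion_sheaf \<V> S)) = c1" .
  qed
  then have h: "h0 V E \<sigma> \<V> S + vdim families = c0 + D S" "h1 V E \<sigma> \<V> S + vdim families = c1 + D S"
    if "S \<in> U" for S
    using cohomology_dim[of S, OF sub[OF that]] that by (simp_all add: D_def)
  \<comment> \<open>Stated for any \<open>f\<close> that differs from \<open>D\<close> by a
    constant, to cover \<open>h0\<close> and \<open>h1\<close> alike; a bound on \<open>f\<close> is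
    a shifted bound on \<open>D\<close>.\<close>
  have "upper_semicontinuous (subtopology ?Z U) (\<lambda>S. int (f S))"
    if f: "\<And>S. S \<in> U \<Longrightarrow> f S + vdim families = k + D S" for f k
    unfolding upper_semicontinuous_def
  proof
    fix a
    have "int (f S) = int k + int (D S) - int (vdim families)" if "S \<in> U" for S
      using f[OF that] by linarith
    then have "{S \<in> topspace (subtopology ?Z U). int (f S) < a} =
        {S \<in> U. int (D S) < a + int (vdim families) - int k}"
      unfolding top by auto
    then show "openin (subtopology ?Z U) {S \<in> topspace (subtopology ?Z U). int (f S) < a}"
      using D_open by simp
  qed
  from this[OF h(1)] this[OF h(2)] show ?thesis
  proof (intro conjI impI)
    assume "U \<noteq> {}"
    then obtain S0 where S0: "S0 \<in> U" "\<And>T. T \<in> U \<Longrightarrow> D S0 \<le> D T"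
      using ex_has_least_nat[of "\<lambda>S. S \<in> U" _ D] by blast
    \<comment> \<open>For integer values, being below the minimum plus one means attaining the
      minimum, so the locus of minimal \<open>D\<close> is an open sublevel set.\<close>
    define W where "W = {S \<in> U. int (D S) < int (D S0) + 1}"
    have "h0 V E \<sigma> \<V> S \<le> h0 V E \<sigma> \<V> T \<and> h1 V E \<sigma> \<V> S \<le> h1 V E \<sigma> \<V> T"
      if "S \<in> W" "T \<in> U" for S T
    proof -
      have "S \<in> U" "D S \<le> D T" using that S0(2)[OF that(2)] by (auto simp: W_def)
      then show ?thesis using h[of S] h[OF that(2)] by linarith
    qed
    moreover have "openin (subtopology ?Z U) W" unfolding W_def by (rule D_open)
    moreover have "W \<noteq> {}" using S0(1) by (auto simp: W_def)
    ultimately show "\<exists>W. openin (subtopology ?Z U) W \<and> W \<noteq> {} \<and>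
        (\<forall>S\<in>W. \<forall>T\<in>U. h0 V E \<sigma> \<V> S \<le> h0 V E \<sigma> \<V> T \<and> h1 V E \<sigma> \<V> S \<le> h1 V E \<sigma> \<V> T)"
      by blast
  qed
qed

end
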